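(* Let $p$ be a prime, $1<r<\infty$ and $\alpha>0$, and let the $p$-adic Hardy operator be defined by $$\mathcal{H}^pf(x)=\frac{1}{|x|_p}\int_{|y|_p\le|x|_p}f(y)\,dy,\qquad x\in\mathbb{Q}_p^*.$$ If $0<1/r+\alpha<1$, then there is a constant $C>0$ such that for any $f\in\mathfrak{B}_{r,\alpha}(\mathbb{Q}_p^* )$, $$\|\mathcal{H}^pf\|_{\mathfrak{B}_{r,\alpha}(\mathbb{Q}_p^* )}\le C\,\|f\|_{\mathfrak{B}_{r,\alpha}(\mathbb{Q}_p^* )}.$$
   Context: $\mathbb{Q}_p$ is the field of $p$-adic numbers with absolute value $|\cdot|_p$, and $\mathbb{Q}_p^*=\mathbb{Q}_p\setminus\{0\}$. $dx$ is the Haar measure on the additive group $\mathbb{Q}_p$ normalized so that $\{|x|_p\le1\}$ has measure $1$, and $|E|$ denotes the Haar measure of $E$. For $n\in\mathbb{Z}$, $B^n=\{x\in\mathbb{Q}_p:|x|_p\le p^n\}$, so $|B^n|=p^n$. A function $a:\mathbb{Q}_p^*\to\mathbb{C}$ is a central $(r,\alpha)$-block if there exists $n\in\mathbb{Z}$ such that $\operatorname{supp}a\subset B^n$ and $\|a\|_{L^r}\le|B^n|^{-\alpha}$. The block space $\mathfrak{B}_{r,\alpha}(\mathbb{Q}_p^* )$ is the set of all $f\in L^r_{\mathrm{loc}}(\mathbb{Q}_p^* )$ that can be written as $f=\sum_{k=1}^\infty\lambda_ka_k$ (almost everywhere) with scalars $\lambda_k$ satisfying $\sum_k|\lambda_k|<\infty$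 and each $a_k$ a central $(r,\alpha)$-block; its norm is $\|f\|_{\mathfrak{B}_{r,\alpha}(\mathbb{Q}_p^* )}=\inf\sum_{k=1}^\infty|\lambda_k|$, the infimum being over all such decompositions of $f$. *)

theory Defs
  imports "HOL-Analysis.Analysis" "Berlekamp_Zassenhaus.Finite_Field"
begin

section \<open>The $p$-adic absolute value on the rationals\<close>

definition padic_abs :: "nat \<Rightarrow> rat \<Rightarrow> real" where
  "padic_abs p q = (if q = 0 then 0 else
     real p powi (int (multiplicity (int p) (snd (quotient_of q)))
                - int (multiplicity (int p) (fst (quotient_of q)))))"

lemma padic_abs_frac:
  assumes p: "prime p" and ab: "a \<noteq> 0" "b \<noteq> 0"
  shows "padic_abs p (of_int a / of_int b) =
    real p powi (int (multiplicity (int p) b) - int (multiplicity (int p) a))"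
proof -
  let ?q = "of_int a / of_int b :: rat"
  obtain c d where cd: "quotient_of ?q = (c, d)" by (cases "quotient_of ?q") auto
  have d: "d > 0" using cd quotient_of_denom_pos by blast
  have eq: "?q = of_int c / of_int d" using cd quotient_of_div by blast
  have q: "?q \<noteq> 0" using ab by simp
  then have c: "c \<noteq> 0" using eq by auto
  have "of_int a * of_int d = (of_int c * of_int b :: rat)"
    using eq ab d by (simp add: field_simps)
  then have ad: "a * d = c * b" by (metis of_int_eq_iff of_int_mult)
  have pe: "prime_elem (int p)" using p by simp
  have "multiplicity (int p) a + multiplicity (int p) d = multiplicity (int p) c + multiplicity (int p) b"
    using arg_cong[OF ad, of "multiplicity (int p)"] ab c d
    by (simp add: prime_elem_multiplicity_mult_distrib[OF pe])
  then have "int (multiplicity (int p) d) - int (multiplicity (int p) c) =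
      int (multiplicity (int p) b) - int (multiplicity (int p) a)" by linarith
  then show ?thesis using q cd by (simp add: padic_abs_def)
qed

lemma padic_abs_0 [simp]: "padic_abs p 0 = 0"
  by (simp add: padic_abs_def)

lemma padic_abs_1 [simp]: "padic_abs p 1 = 1"
  by (simp add: padic_abs_def)

lemma padic_abs_nonneg [simp]: "padic_abs p x \<ge> 0"
  by (simp add: padic_abs_def)

lemma padic_abs_eq_0_iff: "prime p \<Longrightarrow> padic_abs p x = 0 \<longleftrightarrow> x = 0"
  by (auto simp: padic_abs_def prime_gt_0_nat)

lemma rat_frac_cases:
  fixes x :: rat
  obtains "x = 0" | a b where "a \<noteq> 0" "b \<noteq> 0" "x = of_int a / of_int b"
proof (cases "x = 0")
  case False
  obtain c d where cd: "quotient_of x = (c, d)" by (cases "quotient_of x") auto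
  have "d > 0" using cd quotient_of_denom_pos by blast
  moreover have "x = of_int c / of_int d" using cd quotient_of_div by blast
  ultimately show ?thesis using False that(2)[of c d] by auto
qed (use that in auto)

lemma padic_abs_minus [simp]: "prime p \<Longrightarrow> padic_abs p (- x) = padic_abs p x"
proof (cases x rule: rat_frac_cases)
  case (2 a b)
  assume p: "prime p"
  have "padic_abs p (of_int (- a) / of_int b) = padic_abs p (of_int a / of_int b)"
    using 2 p multiplicity_times_unit_right[of "-1 :: int" "int p" a]
    by (subst (1 2) padic_abs_frac) auto
  then show ?thesis using 2 by simp
qed auto

lemma padic_abs_minus_commute: "prime p \<Longrightarrow> padic_abs p (x - y) = padic_abs p (y - x)"
  using padic_abs_minus[of p "x - y"] by simp

lemma padic_abs_mult: "prime p \<Longrightarrow> padic_abs p (x * y) = padic_abs p x * padic_abs p y"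
proof (cases x rule: rat_frac_cases)
  case (2 a b)
  assume p: "prime p"
  have pe: "prime_elem (int p)" using p by simp
  have p0: "real p \<noteq> 0" using p by (simp add: prime_gt_0_nat)
  show ?thesis
  proof (cases y rule: rat_frac_cases)
    case 1
    then show ?thesis by simp
  next
    case y: (2 c d)
    have "x * y = of_int (a * c) / of_int (b * d)" using 2 y by simp
    then have "padic_abs p (x * y) =
        real p powi (int (multiplicity (int p) (b * d)) - int (multiplicity (int p) (a * c)))"
      using 2 y p by (simp add: padic_abs_frac del: of_int_mult)
    also have "\<dots> = padic_abs p x * padic_abs p y"
      using 2 y p p0 by (simp add: padic_abs_frac prime_elem_multiplicity_mult_distrib[OF pe]
          power_int_diff power_int_add power_add)
    finally show ?thesis .
  qed
qed auto

lemma padic_abs_add_le_max: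
  assumes p: "prime p"
  shows "padic_abs p (x + y) \<le> max (padic_abs p x) (padic_abs p y)"
proof (cases "x = 0 \<or> y = 0 \<or> x + y = 0")
  case True
  then show ?thesis by (auto simp: le_max_iff_disj)
next
  case False
  obtain a b where x: "a \<noteq> 0" "b \<noteq> 0" "x = of_int a / of_int b"
    using False by (cases x rule: rat_frac_cases) auto
  obtain c d where y: "c \<noteq> 0" "d \<noteq> 0" "y = of_int c / of_int d"
    using False by (cases y rule: rat_frac_cases) auto
  let ?m = "multiplicity (int p)"
  have p1: "real p \<ge> 1" using prime_gt_0_nat[OF p] by linarith
  have x': "x = of_int (a * d) / of_int (b * d)" using x y by simp
  have y': "y = of_int (c * b) / of_int (b * d)" using x y by simp
  have xy: "x + y = of_int (a * d + c * b) / of_int (b * d)" using x y by (simp add: field_simps)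
  have nz: "a * d + c * b \<noteq> 0" using xy False by (metis div_0 of_int_0)
  have up: "\<not> is_unit (int p)" using prime_gt_1_nat[OF p] by simp
  have dv: "int p ^ min (?m (a * d)) (?m (c * b)) dvd a * d + c * b"
    by (intro dvd_add multiplicity_dvd') auto
  have "min (?m (a * d)) (?m (c * b)) \<le> ?m (a * d + c * b)"
    by (rule multiplicity_geI[OF nz up dv])
  then consider "?m (a * d) \<le> ?m (a * d + c * b)" | "?m (c * b) \<le> ?m (a * d + c * b)"
    by linarith
  then show ?thesis
  proof cases
    case 1
    then have "padic_abs p (x + y) \<le> padic_abs p x"
      unfolding xy using nz x(1,2) y(1,2) p1
      by (subst x') (simp add: padic_abs_frac[OF p] power_int_increasing del: of_int_mult of_int_add)
    then show ?thesis by simp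
  next
    case 2
    then have "padic_abs p (x + y) \<le> padic_abs p y"
      unfolding xy using nz x(1,2) y(1,2) p1
      by (subst y') (simp add: padic_abs_frac[OF p] power_int_increasing del: of_int_mult of_int_add)
    then show ?thesis by simp
  qed
qed

lemma padic_abs_triangle:
  "prime p \<Longrightarrow> padic_abs p (x + y) \<le> padic_abs p x + padic_abs p y"
  using padic_abs_add_le_max[of p x y] padic_abs_nonneg[of p x] padic_abs_nonneg[of p y] by linarith

lemma padic_abs_triangle_diff:
  "prime p \<Longrightarrow> \<bar>padic_abs p x - padic_abs p y\<bar> \<le> padic_abs p (x - y)"
  using padic_abs_triangle[of p "x - y" y] padic_abs_triangle[of p "y - x" x]
    padic_abs_minus_commute[of p x y] by simp


section \<open>The field of $p$-adic numbers as the completion of the rationals\<close>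

text \<open>The prime is the cardinality of the type parameter: \<open>'p padic\<close> is the field of
  \<open>p\<close>-adic numbers for \<open>p = CARD('p)\<close>.  It consists of the Cauchy sequences of rationals
  for the \<open>p\<close>-adic absolute value modulo the null sequences.\<close>

definition padic_null :: "nat \<Rightarrow> (nat \<Rightarrow> rat) \<Rightarrow> bool" where
  "padic_null p X \<longleftrightarrow> (\<lambda>n. padic_abs p (X n)) \<longlonglongrightarrow> 0"

definition padic_cauchy :: "nat \<Rightarrow> (nat \<Rightarrow> rat) \<Rightarrow> bool" where
  "padic_cauchy p X \<longleftrightarrow> (\<forall>e>0. \<exists>N. \<forall>m\<ge>N. \<forall>n\<ge>N. padic_abs p (X m - X n) < e)"

definition padic_rel :: "nat \<Rightarrow> (nat \<Rightarrow> rat) \<Rightarrow> (nat \<Rightarrow> rat) \<Rightarrow> bool" where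
  "padic_rel p X Y \<longleftrightarrow> padic_cauchy p X \<and> padic_cauchy p Y \<and> padic_null p (\<lambda>n. X n - Y n)"

lemma padic_null_le:
  assumes "padic_null p X" and "\<And>n. padic_abs p (Y n) \<le> padic_abs p (X n)"
  shows "padic_null p Y"
  using assms(1) unfolding padic_null_def
  by (rule Lim_null_comparison[rotated]) (simp add: assms(2))

lemma padic_null_minus: "prime p \<Longrightarrow> padic_null p X \<Longrightarrow> padic_null p (\<lambda>n. - X n)"
  by (simp add: padic_null_def)

lemma padic_null_add:
  assumes p: "prime p" and X: "padic_null p X" and Y: "padic_null p Y"
  shows "padic_null p (\<lambda>n. X n + Y n)"
proof -
  have "(\<lambda>n. padic_abs p (X n) + padic_abs p (Y n)) \<longlonglongrightarrow> 0"
    using tendsto_add[OF X[unfolded padic_null_def] Y[unfolded padic_null_def]] by simp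
  then show ?thesis
    unfolding padic_null_def
    by (rule Lim_null_comparison[rotated]) (simp add: padic_abs_triangle[OF p])
qed

lemma padic_null_diff:
  "prime p \<Longrightarrow> padic_null p X \<Longrightarrow> padic_null p Y \<Longrightarrow> padic_null p (\<lambda>n. X n - Y n)"
  using padic_null_add[of p X "\<lambda>n. - Y n"] padic_null_minus[of p Y] by simp

lemma padic_cauchy_const [simp]: "padic_cauchy p (\<lambda>n. c)"
  by (simp add: padic_cauchy_def)

lemma padic_cauchy_abs:
  assumes p: "prime p" and X: "padic_cauchy p X"
  shows "Cauchy (\<lambda>n. padic_abs p (X n))"
proof (rule metric_CauchyI)
  fix e :: real assume "e > 0"
  then obtain N where "\<forall>m\<ge>N. \<forall>n\<ge>N. padic_abs p (X m - X n) < e"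
    using X unfolding padic_cauchy_def by blast
  then show "\<exists>M. \<forall>m\<ge>M. \<forall>n\<ge>M. dist (padic_abs p (X m)) (padic_abs p (X n)) < e"
    using padic_abs_triangle_diff[OF p] unfolding dist_real_def by (meson le_less_trans)
qed

lemma padic_cauchy_tendsto:
  assumes "prime p" and "padic_cauchy p X"
  shows "(\<lambda>n. padic_abs p (X n)) \<longlonglongrightarrow> lim (\<lambda>n. padic_abs p (X n))"
  using padic_cauchy_abs[OF assms] by (simp add: Cauchy_convergent_iff convergent_LIMSEQ_iff)

lemma padic_cauchy_bounded:
  assumes "prime p" and "padic_cauchy p X"
  shows "\<exists>B>0. \<forall>n. padic_abs p (X n) \<le> B"
proof -
  have "Bseq (\<lambda>n. padic_abs p (X n))"
    using padic_cauchy_abs[OF assms] by (rule Cauchy_Bseq)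
  then show ?thesis by (auto simp: Bseq_def)
qed

lemma padic_cauchy_minus: "prime p \<Longrightarrow> padic_cauchy p X \<Longrightarrow> padic_cauchy p (\<lambda>n. - X n)"
proof -
  assume p: "prime p" and X: "padic_cauchy p X"
  have "- X m - - X n = - (X m - X n)" for m n by simp
  then show ?thesis using X p unfolding padic_cauchy_def by (simp only: padic_abs_minus)
qed

lemma padic_cauchy_add:
  assumes p: "prime p" and X: "padic_cauchy p X" and Y: "padic_cauchy p Y"
  shows "padic_cauchy p (\<lambda>n. X n + Y n)"
  unfolding padic_cauchy_def
proof (intro allI impI)
  fix e :: real assume e: "e > 0"
  obtain N1 where N1: "\<forall>m\<ge>N1. \<forall>n\<ge>N1. padic_abs p (X m - X n) < e / 2"
    using X e unfolding padic_cauchy_def by (meson half_gt_zero)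
  obtain N2 where N2: "\<forall>m\<ge>N2. \<forall>n\<ge>N2. padic_abs p (Y m - Y n) < e / 2"
    using Y e unfolding padic_cauchy_def by (meson half_gt_zero)
  have "padic_abs p (X m + Y m - (X n + Y n)) < e" if "m \<ge> max N1 N2" "n \<ge> max N1 N2" for m n
  proof -
    have "padic_abs p (X m + Y m - (X n + Y n)) = padic_abs p ((X m - X n) + (Y m - Y n))"
      by (simp add: algebra_simps)
    also have "\<dots> \<le> padic_abs p (X m - X n) + padic_abs p (Y m - Y n)"
      by (rule padic_abs_triangle[OF p])
    also have "\<dots> < e / 2 + e / 2"
      using N1 N2 that by (intro add_strict_mono) auto
    finally show ?thesis by simp
  qed
  then show "\<exists>N. \<forall>m\<ge>N. \<forall>n\<ge>N. padic_abs p (X m + Y m - (X n + Y n)) < e" by blast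
qed

lemma padic_null_mult_bounded:
  assumes p: "prime p" and X: "padic_cauchy p X" and Y: "padic_null p Y"
  shows "padic_null p (\<lambda>n. X n * Y n)"
proof -
  have "(\<lambda>n. padic_abs p (X n) * padic_abs p (Y n)) \<longlonglongrightarrow> lim (\<lambda>n. padic_abs p (X n)) * 0"
    by (intro tendsto_mult padic_cauchy_tendsto p X Y[unfolded padic_null_def])
  then show ?thesis by (simp add: padic_null_def padic_abs_mult[OF p])
qed

lemma padic_cauchy_mult:
  assumes p: "prime p" and X: "padic_cauchy p X" and Y: "padic_cauchy p Y"
  shows "padic_cauchy p (\<lambda>n. X n * Y n)"
  unfolding padic_cauchy_def
proof (intro allI impI)
  fix e :: real assume e: "e > 0"
  obtain A where A: "A > 0" "\<And>n. padic_abs p (X n) \<le> A"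
    using padic_cauchy_bounded[OF p X] by blast
  obtain B where B: "B > 0" "\<And>n. padic_abs p (Y n) \<le> B"
    using padic_cauchy_bounded[OF p Y] by blast
  obtain N1 where N1: "\<forall>m\<ge>N1. \<forall>n\<ge>N1. padic_abs p (X m - X n) < e / (2 * B)"
    using X e B unfolding padic_cauchy_def by (meson divide_pos_pos mult_pos_pos zero_less_numeral)
  obtain N2 where N2: "\<forall>m\<ge>N2. \<forall>n\<ge>N2. padic_abs p (Y m - Y n) < e / (2 * A)"
    using Y e A unfolding padic_cauchy_def by (meson divide_pos_pos mult_pos_pos zero_less_numeral)
  have "padic_abs p (X m * Y m - X n * Y n) < e" if "m \<ge> max N1 N2" "n \<ge> max N1 N2" for m n
  proof -
    have "padic_abs p (X m * Y m - X n * Y n) = padic_abs p (X m * (Y m - Y n) + (X m - X n) * Y n)"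
      by (simp add: algebra_simps)
    also have "\<dots> \<le> padic_abs p (X m) * padic_abs p (Y m - Y n) + padic_abs p (X m - X n) * padic_abs p (Y n)"
      using padic_abs_triangle[OF p, of "X m * (Y m - Y n)" "(X m - X n) * Y n"]
      by (simp only: padic_abs_mult[OF p])
    also have "\<dots> \<le> A * padic_abs p (Y m - Y n) + padic_abs p (X m - X n) * B"
      using A B less_imp_le[OF A(1)] by (intro add_mono mult_right_mono mult_left_mono) simp_all
    also have "\<dots> < A * (e / (2 * A)) + (e / (2 * B)) * B"
      using N1 N2 that A B by (intro add_strict_mono mult_strict_left_mono mult_strict_right_mono) auto
    also have "\<dots> = e" using A B by simp
    finally show ?thesis .
  qed
  then show "\<exists>N. \<forall>m\<ge>N. \<forall>n\<ge>N. padic_abs p (X m * Y m - X n * Y n) < e" by blast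
qed

lemma padic_cauchy_not_null:
  assumes p: "prime p" and X: "padic_cauchy p X" and nz: "\<not> padic_null p X"
  shows "\<exists>b>0. \<exists>k. \<forall>n\<ge>k. b < padic_abs p (X n)"
proof -
  let ?l = "lim (\<lambda>n. padic_abs p (X n))"
  have t: "(\<lambda>n. padic_abs p (X n)) \<longlonglongrightarrow> ?l" by (rule padic_cauchy_tendsto[OF p X])
  have "?l \<ge> 0" using t by (rule LIMSEQ_le_const) auto
  moreover have "?l \<noteq> 0" using t nz by (auto simp: padic_null_def)
  ultimately have l: "?l > 0" by simp
  then have "eventually (\<lambda>n. padic_abs p (X n) > ?l / 2) sequentially"
    by (intro order_tendstoD(1)[OF t]) auto
  then show ?thesis using l by (intro exI[of _ "?l / 2"]) (auto simp: eventually_sequentially)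
qed

lemma padic_cauchy_inverse:
  assumes p: "prime p" and X: "padic_cauchy p X" and nz: "\<not> padic_null p X"
  shows "padic_cauchy p (\<lambda>n. inverse (X n))"
  unfolding padic_cauchy_def
proof (intro allI impI)
  fix e :: real assume e: "e > 0"
  obtain b k where b: "b > 0" and k: "\<forall>n\<ge>k. b < padic_abs p (X n)"
    using padic_cauchy_not_null[OF assms] by blast
  obtain N where N: "\<forall>m\<ge>N. \<forall>n\<ge>N. padic_abs p (X m - X n) < e * (b * b)"
    using X e b unfolding padic_cauchy_def by (meson mult_pos_pos)
  have "padic_abs p (inverse (X m) - inverse (X n)) < e" if "m \<ge> max k N" "n \<ge> max k N" for m n
  proof -
    have m: "b < padic_abs p (X m)" and n: "b < padic_abs p (X n)" using k that by auto
    then have nz: "X m \<noteq> 0" "X n \<noteq> 0" using b by auto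
    have "(inverse (X m) - inverse (X n)) * (X m * X n) = X n - X m"
      using nz by (simp add: field_simps)
    then have "padic_abs p (inverse (X m) - inverse (X n)) * (padic_abs p (X m) * padic_abs p (X n)) =
        padic_abs p (X n - X m)" by (metis padic_abs_mult[OF p])
    also have "\<dots> < e * (b * b)" using N that by auto
    also have "\<dots> \<le> e * (padic_abs p (X m) * padic_abs p (X n))"
      using e b m n by (intro mult_left_mono mult_mono) auto
    finally show ?thesis using b m n by (meson mult_less_cancel_right_pos mult_pos_pos order.strict_trans)
  qed
  then show "\<exists>N. \<forall>m\<ge>N. \<forall>n\<ge>N. padic_abs p (inverse (X m) - inverse (X n)) < e" by blast
qed

lemma padic_null_inverse_mult:
  assumes p: "prime p" and X: "padic_cauchy p X" and nz: "\<not> padic_null p X"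
  shows "padic_null p (\<lambda>n. inverse (X n) * X n - 1)"
proof -
  obtain b k where b: "b > 0" and k: "\<forall>n\<ge>k. b < padic_abs p (X n)"
    using padic_cauchy_not_null[OF assms] by blast
  have "eventually (\<lambda>n. padic_abs p (inverse (X n) * X n - 1) = 0) sequentially"
    unfolding eventually_sequentially
  proof (intro exI allI impI)
    fix n assume "n \<ge> k"
    then have "X n \<noteq> 0" using b k by force
    then show "padic_abs p (inverse (X n) * X n - 1) = 0" by simp
  qed
  then show ?thesis unfolding padic_null_def by (rule tendsto_eventually)
qed

lemma padic_rel_refl: "padic_cauchy p X \<Longrightarrow> padic_rel p X X"
  by (simp add: padic_rel_def padic_null_def)

lemma padic_rel_part_equivp: "prime p \<Longrightarrow> part_equivp (padic_rel p)"
proof (rule part_equivpI)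
  assume p: "prime p"
  show "\<exists>X. padic_rel p X X" by (rule exI[of _ "\<lambda>_. 0"]) (simp add: padic_rel_refl)
  show "symp (padic_rel p)"
    using p padic_abs_minus_commute[OF p]
    by (auto simp: symp_def padic_rel_def padic_null_def)
  show "transp (padic_rel p)"
  proof (rule transpI)
    fix X Y Z assume "padic_rel p X Y" "padic_rel p Y Z"
    then show "padic_rel p X Z"
      using padic_null_add[OF p, of "\<lambda>n. X n - Y n" "\<lambda>n. Y n - Z n"] by (auto simp: padic_rel_def)
  qed
qed

lemma padic_rel_null_iff:
  assumes p: "prime p" and XY: "padic_rel p X Y"
  shows "padic_null p X \<longleftrightarrow> padic_null p Y"
  using XY padic_null_diff[OF p, of X "\<lambda>n. X n - Y n"] padic_null_add[OF p, of "\<lambda>n. X n - Y n" Y]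
  by (auto simp: padic_rel_def)

lemma padic_rel_mult:
  assumes p: "prime p" and 1: "padic_rel p X X'" and 2: "padic_rel p Y Y'"
  shows "padic_rel p (\<lambda>n. X n * Y n) (\<lambda>n. X' n * Y' n)"
proof -
  have "padic_null p (\<lambda>n. X n * (Y n - Y' n) + Y' n * (X n - X' n))"
    using 1 2 unfolding padic_rel_def by (intro padic_null_add padic_null_mult_bounded p) auto
  moreover have "(\<lambda>n. X n * (Y n - Y' n) + Y' n * (X n - X' n)) = (\<lambda>n. X n * Y n - X' n * Y' n)"
    by (auto simp: algebra_simps)
  ultimately show ?thesis using 1 2 by (auto simp: padic_rel_def padic_cauchy_mult p)
qed

lemma padic_rel_inverse:
  assumes p: "prime p" and XY: "padic_rel p X Y" and nz: "\<not> padic_null p X"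
  shows "padic_rel p (\<lambda>n. inverse (X n)) (\<lambda>n. inverse (Y n))"
proof -
  have X: "padic_cauchy p X" and Y: "padic_cauchy p Y" and nzY: "\<not> padic_null p Y"
    using XY nz padic_rel_null_iff[OF p XY] by (auto simp: padic_rel_def)
  let ?X' = "\<lambda>n. inverse (X n)" and ?Y' = "\<lambda>n. inverse (Y n)"
  have cX: "padic_cauchy p ?X'" and cY: "padic_cauchy p ?Y'"
    using padic_cauchy_inverse[OF p X nz] padic_cauchy_inverse[OF p Y nzY] by auto
  have a: "padic_null p (\<lambda>n. (?X' n * ?Y' n) * (X n - Y n))"
    using XY unfolding padic_rel_def
    by (intro padic_null_mult_bounded padic_cauchy_mult p cX cY) auto
  have b: "padic_null p (\<lambda>n. ?Y' n * (?X' n * X n - 1))"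
    by (intro padic_null_mult_bounded padic_null_inverse_mult p cY X nz)
  have c: "padic_null p (\<lambda>n. ?X' n * (?Y' n * Y n - 1))"
    by (intro padic_null_mult_bounded padic_null_inverse_mult p cX Y nzY)
  have "padic_null p (\<lambda>n. ?Y' n * (?X' n * X n - 1) - ?X' n * (?Y' n * Y n - 1)
      - (?X' n * ?Y' n) * (X n - Y n))"
    by (intro padic_null_diff p a b c)
  moreover have "(\<lambda>n. ?Y' n * (?X' n * X n - 1) - ?X' n * (?Y' n * Y n - 1)
      - (?X' n * ?Y' n) * (X n - Y n)) = (\<lambda>n. ?X' n - ?Y' n)"
    by (auto simp: algebra_simps)
  ultimately show ?thesis using cX cY by (simp add: padic_rel_def)
qed

text \<open>The command \<open>quotient_type\<close> does not handle a relation with a type parameter that is absent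
  from the representation type, hence the explicit type of equivalence classes.\<close>

typedef (overloaded) ('p :: prime_card) padic =
  "{C. \<exists>X. padic_rel CARD('p) X X \<and> C = Collect (padic_rel CARD('p) X)}"
  by (blast intro: padic_rel_refl padic_cauchy_const)

definition abs_padic :: "(nat \<Rightarrow> rat) \<Rightarrow> 'p :: prime_card padic" where
  "abs_padic X = Abs_padic (Collect (padic_rel CARD('p) X))"

definition rep_padic :: "'p :: prime_card padic \<Rightarrow> nat \<Rightarrow> rat" where
  "rep_padic x = (SOME X. X \<in> Rep_padic x)"

definition cr_padic :: "(nat \<Rightarrow> rat) \<Rightarrow> 'p :: prime_card padic \<Rightarrow> bool" where
  "cr_padic = (\<lambda>X x. padic_rel CARD('p) X X \<and> abs_padic X = x)"

lemma Quotient_padic: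
  "Quotient (padic_rel CARD('p)) abs_padic rep_padic (cr_padic :: _ \<Rightarrow> 'p :: prime_card padic \<Rightarrow> bool)"
proof -
  interpret q: quot_type "padic_rel CARD('p)" "Abs_padic :: _ \<Rightarrow> 'p padic" Rep_padic
  proof
    show "part_equivp (padic_rel CARD('p))" by (rule padic_rel_part_equivp[OF prime_card])
    show "\<And>y :: 'p padic. \<exists>x. padic_rel CARD('p) x x \<and> Rep_padic y = Collect (padic_rel CARD('p) x)"
      using Rep_padic by blast
    show "\<And>x :: 'p padic. Abs_padic (Rep_padic x) = x" by (rule Rep_padic_inverse)
    show "\<And>c. \<exists>x. padic_rel CARD('p) x x \<and> c = Collect (padic_rel CARD('p) x) \<Longrightarrow>
        Rep_padic (Abs_padic c :: 'p padic) = c"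
      by (rule Abs_padic_inverse) simp
    show "\<And>x y :: 'p padic. (Rep_padic x = Rep_padic y) = (x = y)" by (rule Rep_padic_inject)
  qed
  have a: "(abs_padic :: _ \<Rightarrow> 'p padic) = q.abs" by (auto simp: abs_padic_def q.abs_def)
  have r: "(rep_padic :: 'p padic \<Rightarrow> _) = q.rep" by (auto simp: rep_padic_def q.rep_def)
  show ?thesis
    using q.Quotient unfolding a[symmetric] r[symmetric]
    by (rule Quotient3_to_Quotient) (simp add: cr_padic_def)
qed

setup_lifting Quotient_padic

instantiation padic :: (prime_card) field
begin

lift_definition zero_padic :: "'a padic" is "\<lambda>n. 0"
  by (simp add: padic_rel_refl)

lift_definition one_padic :: "'a padic" is "\<lambda>n. 1"
  by (simp add: padic_rel_refl)

lift_definition plus_padic :: "'a padic \<Rightarrow> 'a padic \<Rightarrow> 'a padic" is "\<lambda>X Y n. X n + Y n"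
proof -
  fix X X' Y Y' :: "nat \<Rightarrow> rat"
  assume a: "padic_rel CARD('a) X X'" "padic_rel CARD('a) Y Y'"
  have "padic_null CARD('a) (\<lambda>n. (X n + Y n) - (X' n + Y' n))"
    unfolding add_diff_add using a by (intro padic_null_add prime_card) (auto simp: padic_rel_def)
  then show "padic_rel CARD('a) (\<lambda>n. X n + Y n) (\<lambda>n. X' n + Y' n)"
    using a unfolding padic_rel_def by (intro conjI padic_cauchy_add prime_card) auto
qed

lift_definition uminus_padic :: "'a padic \<Rightarrow> 'a padic" is "\<lambda>X n. - X n"
proof -
  fix X Y :: "nat \<Rightarrow> rat"
  assume a: "padic_rel CARD('a) X Y"
  have "padic_null CARD('a) (\<lambda>n. - X n - - Y n)"
    unfolding minus_diff_minus using a
    by (intro padic_null_minus prime_card) (auto simp: padic_rel_def)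
  then show "padic_rel CARD('a) (\<lambda>n. - X n) (\<lambda>n. - Y n)"
    using a unfolding padic_rel_def by (intro conjI padic_cauchy_minus prime_card) auto
qed

lift_definition times_padic :: "'a padic \<Rightarrow> 'a padic \<Rightarrow> 'a padic" is "\<lambda>X Y n. X n * Y n"
  by (rule padic_rel_mult[OF prime_card])

lift_definition inverse_padic :: "'a padic \<Rightarrow> 'a padic"
  is "\<lambda>X. if padic_null CARD('a) X then (\<lambda>n. 0) else (\<lambda>n. inverse (X n))"
proof -
  fix X Y :: "nat \<Rightarrow> rat"
  assume a: "padic_rel CARD('a) X Y"
  show "padic_rel CARD('a) (if padic_null CARD('a) X then \<lambda>n. 0 else (\<lambda>n. inverse (X n)))
      (if padic_null CARD('a) Y then \<lambda>n. 0 else (\<lambda>n. inverse (Y n)))"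
  proof (cases "padic_null CARD('a) X")
    case True
    then show ?thesis using padic_rel_null_iff[OF prime_card a] by (simp add: padic_rel_refl)
  next
    case False
    then show ?thesis
      using padic_rel_null_iff[OF prime_card a] padic_rel_inverse[OF prime_card a] by simp
  qed
qed

definition minus_padic :: "'a padic \<Rightarrow> 'a padic \<Rightarrow> 'a padic" where
  "minus_padic x y = x + - y"

definition divide_padic :: "'a padic \<Rightarrow> 'a padic \<Rightarrow> 'a padic" where
  "divide_padic x y = x * inverse y"

instance
proof
  fix a b c :: "'a padic"
  note [simp] = padic_rel_refl padic_cauchy_add[OF prime_card] padic_cauchy_mult[OF prime_card]
    padic_cauchy_minus[OF prime_card]
  have C: "padic_cauchy CARD('a) X" if "padic_rel CARD('a) X X" for X
    using that by (simp add: padic_rel_def)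
  show "a + b + c = a + (b + c)"
    by transfer (auto dest!: C simp: add.assoc)
  show "a + b = b + a"
    by transfer (auto dest!: C simp: add.commute)
  show "0 + a = a"
    by transfer (auto dest!: C)
  show "- a + a = 0"
    by transfer (auto dest!: C)
  show "a - b = a + - b"
    by (rule minus_padic_def)
  show "a * b * c = a * (b * c)"
    by transfer (auto dest!: C simp: mult.assoc)
  show "a * b = b * a"
    by transfer (auto dest!: C simp: mult.commute)
  show "1 * a = a"
    by transfer (auto dest!: C)
  show "(a + b) * c = a * c + b * c"
    by transfer (auto dest!: C simp: distrib_right[symmetric])
  show "(0 :: 'a padic) \<noteq> 1"
    by transfer (auto simp: padic_rel_def padic_null_def padic_abs_minus[OF prime_card] LIMSEQ_const_iff)
  show "a \<noteq> 0 \<Longrightarrow> inverse a * a = 1"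
  proof (transfer, goal_cases)
    case (1 X)
    have c: "padic_cauchy CARD('a) X" using 1(1) by (rule C)
    have n: "\<not> padic_null CARD('a) X" using 1(2) c by (simp add: padic_rel_def)
    show ?case
      using n padic_null_inverse_mult[OF prime_card c n] padic_cauchy_inverse[OF prime_card c n] c
      by (simp add: padic_rel_def)
  qed
  show "a div b = a * inverse b"
    by (rule divide_padic_def)
  show "inverse (0 :: 'a padic) = 0"
    by transfer (auto simp: padic_null_def)
qed

end

text \<open>The constant \<open>norm\<close> is reserved for real normed vector spaces, hence a separate name for the
  absolute value.\<close>

lift_definition padic_norm :: "'a :: prime_card padic \<Rightarrow> real" is "\<lambda>X. lim (\<lambda>n. padic_abs CARD('a) (X n))"
proof -
  fix X Y :: "nat \<Rightarrow> rat"
  assume a: "padic_rel CARD('a) X Y"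
  let ?p = "padic_abs CARD('a)"
  have d: "(\<lambda>n. ?p (X n - Y n)) \<longlonglongrightarrow> 0" using a by (simp add: padic_rel_def padic_null_def)
  have "(\<lambda>n. ?p (X n) - ?p (Y n)) \<longlonglongrightarrow> 0"
    by (rule Lim_null_comparison[OF _ d]) (simp add: padic_abs_triangle_diff[OF prime_card])
  moreover have "(\<lambda>n. ?p (X n) - ?p (Y n)) \<longlonglongrightarrow> lim (\<lambda>n. ?p (X n)) - lim (\<lambda>n. ?p (Y n))"
    using a by (intro tendsto_diff padic_cauchy_tendsto prime_card) (auto simp: padic_rel_def)
  ultimately have "0 = lim (\<lambda>n. ?p (X n)) - lim (\<lambda>n. ?p (Y n))"
    by (rule LIMSEQ_unique)
  then show "lim (\<lambda>n. ?p (X n)) = lim (\<lambda>n. ?p (Y n))" by simp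
qed

instantiation padic :: (prime_card) metric_space
begin

definition dist_padic :: "'a padic \<Rightarrow> 'a padic \<Rightarrow> real" where
  "dist_padic x y = padic_norm (x - y)"

definition uniformity_padic :: "('a padic \<times> 'a padic) filter" where
  "uniformity_padic = (INF e\<in>{0<..}. principal {(x, y). dist x y < e})"

definition open_padic :: "'a padic set \<Rightarrow> bool" where
  "open_padic U \<longleftrightarrow> (\<forall>x\<in>U. \<forall>\<^sub>F (x', y) in uniformity. x' = x \<longrightarrow> y \<in> U)"

instance
proof
  fix x y z :: "'a padic" and U :: "'a padic set"
  show "uniformity = (INF e\<in>{0<..}. principal {(x :: 'a padic, y). dist x y < e})"
    by (rule uniformity_padic_def)
  show "open U \<longleftrightarrow> (\<forall>x\<in>U. \<forall>\<^sub>F (x', y) in uniformity. x' = x \<longrightarrow> y \<in> U)"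
    by (rule open_padic_def)
  have norm0: "padic_norm u = 0 \<longleftrightarrow> u = 0" for u :: "'a padic"
  proof (transfer, goal_cases)
    case (1 X)
    then have c: "padic_cauchy CARD('a) X" by (simp add: padic_rel_def)
    have "padic_rel CARD('a) X (\<lambda>n. 0) \<longleftrightarrow> (\<lambda>n. padic_abs CARD('a) (X n)) \<longlonglongrightarrow> 0"
      using c by (simp add: padic_rel_def padic_null_def)
    also have "\<dots> \<longleftrightarrow> lim (\<lambda>n. padic_abs CARD('a) (X n)) = 0"
      using padic_cauchy_tendsto[OF prime_card c] by (metis limI)
    finally show ?case by (rule sym)
  qed
  have norm_minus: "padic_norm (- u) = padic_norm u" for u :: "'a padic"
    by transfer (simp add: padic_abs_minus[OF prime_card])
  have norm_add: "padic_norm (u + v) \<le> padic_norm u + padic_norm v" for u v :: "'a padic"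
  proof (transfer, goal_cases)
    case (1 X Y)
    then have c: "padic_cauchy CARD('a) X" "padic_cauchy CARD('a) Y" by (auto simp: padic_rel_def)
    show ?case
      using padic_cauchy_tendsto[OF prime_card padic_cauchy_add[OF prime_card c]]
        tendsto_add[OF padic_cauchy_tendsto[OF prime_card c(1)] padic_cauchy_tendsto[OF prime_card c(2)]]
      by (rule LIMSEQ_le) (auto simp: padic_abs_triangle[OF prime_card])
  qed
  show "dist x y = 0 \<longleftrightarrow> x = y"
    by (simp add: dist_padic_def norm0)
  have "padic_norm (x - y) \<le> padic_norm (x - z) + padic_norm (- (y - z))"
    using norm_add[of "x - z" "- (y - z)"] by simp
  then show "dist x y \<le> dist x z + dist y z"
    by (simp only: dist_padic_def norm_minus)
qed

end


section \<open>Haar measure, central blocks and the Hardy operator\<close>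

text \<open>\<open>M\<close> is the Haar measure of the additive group, as a Borel measure, normalized to give
  the closed unit ball measure 1.\<close>

definition is_padic_haar :: "'p :: prime_card padic measure \<Rightarrow> bool" where
  "is_padic_haar M \<longleftrightarrow>
     sets M = sets borel \<and>
     (\<forall>c. \<forall>A \<in> sets borel. emeasure M ((\<lambda>x. c + x) ` A) = emeasure M A) \<and>
     emeasure M {x. padic_norm x \<le> 1} = 1"

definition padic_ball :: "int \<Rightarrow> 'p :: prime_card padic set" where
  "padic_ball n = {x. padic_norm x \<le> real CARD('p) powi n}"

text \<open>A function on the punctured line is represented by a function on the whole type; its value
  at 0 never matters, because \<open>{0}\<close> is a null set and 0 lies in every \<open>padic_ball n\<close>.
  Functions are Borel representatives of almost-everywhere classes.\<close>

definition in_Lr :: "'p :: prime_card padic measure \<Rightarrow> real \<Rightarrow> ('p padic \<Rightarrow> complex) \<Rightarrow> bool" where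
  "in_Lr M r f \<longleftrightarrow> f \<in> borel_measurable M \<and> integrable M (\<lambda>x. norm (f x) powr r)"

definition Lr_norm :: "'p :: prime_card padic measure \<Rightarrow> real \<Rightarrow> ('p padic \<Rightarrow> complex) \<Rightarrow> real" where
  "Lr_norm M r f = (LINT x|M. norm (f x) powr r) powr (1 / r)"

text \<open>Local integrability refers to compact subsets of the punctured line.\<close>

definition in_Lr_loc :: "'p :: prime_card padic measure \<Rightarrow> real \<Rightarrow> ('p padic \<Rightarrow> complex) \<Rightarrow> bool" where
  "in_Lr_loc M r f \<longleftrightarrow> f \<in> borel_measurable M \<and>
     (\<forall>K. compact K \<and> 0 \<notin> K \<longrightarrow> in_Lr M r (\<lambda>x. indicator K x * f x))"

definition central_block ::
  "'p :: prime_card padic measure \<Rightarrow> real \<Rightarrow> real \<Rightarrow> ('p padic \<Rightarrow> complex) \<Rightarrow> bool" where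
  "central_block M r \<alpha> a \<longleftrightarrow> in_Lr M r a \<and>
     (\<exists>n. {x. a x \<noteq> 0} \<subseteq> padic_ball n \<and>
          Lr_norm M r a \<le> measure M (padic_ball n :: 'p padic set) powr (- \<alpha>))"

definition block_decomp :: "'p :: prime_card padic measure \<Rightarrow> real \<Rightarrow> real \<Rightarrow> ('p padic \<Rightarrow> complex)
    \<Rightarrow> (nat \<Rightarrow> complex) \<Rightarrow> (nat \<Rightarrow> 'p padic \<Rightarrow> complex) \<Rightarrow> bool" where
  "block_decomp M r \<alpha> f l a \<longleftrightarrow>
     summable (\<lambda>k. norm (l k)) \<and> (\<forall>k. central_block M r \<alpha> (a k)) \<and>
     (AE x in M. (\<lambda>k. l k * a k x) sums f x)"

definition block_space ::
  "'p :: prime_card padic measure \<Rightarrow> real \<Rightarrow> real \<Rightarrow> ('p padic \<Rightarrow> complex) set" where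
  "block_space M r \<alpha> = {f. in_Lr_loc M r f \<and> (\<exists>l a. block_decomp M r \<alpha> f l a)}"

text \<open>The real-valued infimum is meaningful only for members of \<open>block_space M r \<alpha>\<close>, where the
  set of decompositions is nonempty.\<close>

definition block_norm ::
  "'p :: prime_card padic measure \<Rightarrow> real \<Rightarrow> real \<Rightarrow> ('p padic \<Rightarrow> complex) \<Rightarrow> real" where
  "block_norm M r \<alpha> f = Inf {\<Sum>k. norm (l k) | l. \<exists>a. block_decomp M r \<alpha> f l a}"

definition padic_hardy ::
  "'p :: prime_card padic measure \<Rightarrow> ('p padic \<Rightarrow> complex) \<Rightarrow> 'p padic \<Rightarrow> complex" where
  "padic_hardy M f x = (LINT y:{y. padic_norm y \<le> padic_norm x}|M. f y) / complex_of_real (padic_norm x)"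

end

theory Submission
  imports Defs
begin

text \<open>Write \<open>q = 1/r + \<alpha>\<close>, let \<open>S m\<close> be the sphere of radius \<open>p^m\<close> and \<open>B m\<close> the ball. The function
  \<open>H f\<close> is constant on \<open>S m\<close>, with value \<open>h m = p^(-m)\<close> times the integral of \<open>f\<close> over \<open>B m\<close>. Since
  \<open>p^(-m q)\<close> times the indicator of \<open>S m\<close> is a central block, cutting \<open>H f\<close> into its values on the
  spheres is already a block decomposition, with coefficients \<open>h m * p^(m q)\<close>. A block of \<open>f\<close>
  living on \<open>B n\<close> contributes at most \<open>2 t^\<bar>m - n\<bar>\<close> to the coefficient with index \<open>m\<close>, where
  \<open>t = p^(- min \<alpha> (1 - q)) < 1\<close>: the decay comes from \<open>\<alpha> > 0\<close> for \<open>m < n\<close> and from \<open>q < 1\<close> for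
  \<open>m > n\<close>. The boundedness of \<open>H\<close> on \<open>L\<^sup>r\<close> is not needed.\<close>

section \<open>The $p$-adic absolute value and balls\<close>

lemma padic_norm_eq_dist: "padic_norm x = dist x 0"
  by (simp add: dist_padic_def)

lemma padic_norm_nonneg [simp]: "padic_norm x \<ge> 0"
  by (simp add: padic_norm_eq_dist)

lemma padic_norm_eq_0_iff [simp]: "padic_norm x = 0 \<longleftrightarrow> x = 0"
  by (simp add: padic_norm_eq_dist)

lemma padic_norm_minus [simp]: "padic_norm (- x) = padic_norm x"
  using dist_commute[of x 0] by (simp add: dist_padic_def)

lemma padic_norm_add_le_max:
  fixes x y :: "'p :: prime_card padic"
  shows "padic_norm (x + y) \<le> max (padic_norm x) (padic_norm y)"
proof (transfer, goal_cases)
  case (1 X Y)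
  then have c: "padic_cauchy CARD('p) X" "padic_cauchy CARD('p) Y" by (auto simp: padic_rel_def)
  show ?case
    using padic_cauchy_tendsto[OF prime_card padic_cauchy_add[OF prime_card c]]
      tendsto_max[OF padic_cauchy_tendsto[OF prime_card c(1)] padic_cauchy_tendsto[OF prime_card c(2)]]
    by (rule LIMSEQ_le) (auto intro: padic_abs_add_le_max[OF prime_card])
qed

lemma padic_norm_diff_le_max: "padic_norm (x - y) \<le> max (padic_norm x) (padic_norm y)"
  using padic_norm_add_le_max[of x "- y"] by simp

lift_definition padic_of_rat :: "rat \<Rightarrow> 'p :: prime_card padic" is "\<lambda>q n. q"
  by (simp add: padic_rel_refl)

lemma padic_norm_of_rat: "padic_norm (padic_of_rat q :: 'p padic) = padic_abs CARD('p :: prime_card) q"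
  by transfer (simp add: limI)

lemma padic_of_rat_diff: "(padic_of_rat (a - b) :: 'p :: prime_card padic) = padic_of_rat a - padic_of_rat b"
  unfolding diff_conv_add_uminus by transfer (simp add: padic_rel_refl)

lemma padic_of_rat_dense:
  fixes x :: "'p :: prime_card padic"
  assumes "e > 0"
  shows "\<exists>q. padic_norm (x - padic_of_rat q) < e"
  unfolding diff_conv_add_uminus
proof (transfer fixing: e, goal_cases)
  case (1 X)
  then have c: "padic_cauchy CARD('p) X" by (auto simp: padic_rel_def)
  then obtain N where N: "\<forall>m\<ge>N. \<forall>n\<ge>N. padic_abs CARD('p) (X m - X n) < e / 2"
    using assms unfolding padic_cauchy_def by (meson half_gt_zero)
  have "lim (\<lambda>n. padic_abs CARD('p) (X n + - X N)) \<le> e / 2"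
    using padic_cauchy_tendsto[OF prime_card padic_cauchy_add[OF prime_card c padic_cauchy_const]]
    by (rule LIMSEQ_le_const2) (use N in \<open>auto intro!: exI[of _ N] less_imp_le\<close>)
  then show ?case using assms by (intro exI[of _ "X N"]) simp
qed

lemma padic_abs_values:
  assumes "q \<noteq> 0" obtains n where "padic_abs p q = real p powi n"
  using assms by (auto simp: padic_abs_def)

lemma padic_norm_values:
  fixes x :: "'p :: prime_card padic"
  assumes "x \<noteq> 0"
  obtains n where "padic_norm x = real CARD('p) powi n"
proof -
  have pos: "padic_norm x > 0" using assms padic_norm_nonneg[of x] by (simp add: less_le)
  then obtain q where q: "padic_norm (x - padic_of_rat q) < padic_norm x"
    using padic_of_rat_dense by blast
  let ?q = "padic_of_rat q :: 'p padic"
  have "padic_norm x \<le> max (padic_norm (x - ?q)) (padic_norm ?q)"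
    using padic_norm_add_le_max[of "x - ?q" ?q] by simp
  moreover have "padic_norm ?q \<le> max (padic_norm x) (padic_norm (x - ?q))"
    using padic_norm_diff_le_max[of x "x - ?q"] by simp
  ultimately have eq: "padic_norm x = padic_norm ?q" using q by linarith
  then have "q \<noteq> 0" using pos by (auto simp: padic_norm_of_rat)
  then obtain n where "padic_abs CARD('p) q = real CARD('p) powi n" by (rule padic_abs_values)
  then show ?thesis using that eq by (simp add: padic_norm_of_rat)
qed

lemma padic_abs_of_int_le_1:
  assumes "prime p" shows "padic_abs p (of_int k) \<le> 1"
proof (cases "k = 0")
  case False
  then show ?thesis
    using padic_abs_frac[OF assms, of k 1] prime_gt_1_nat[OF assms]
    by (simp add: power_int_minus inverse_le_1_iff)
qed simp

lemma padic_abs_of_int_eq_1_iff: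
  assumes "prime p" shows "padic_abs p (of_int k) = 1 \<longleftrightarrow> \<not> int p dvd k"
proof (cases "k = 0")
  case False
  have "\<not> is_unit (int p)" using prime_gt_1_nat[OF assms] by simp
  then have "\<not> int p dvd k \<longleftrightarrow> multiplicity (int p) k = 0"
    using False by (metis not_dvd_imp_multiplicity_0 multiplicity_gt_zero_iff less_irrefl)
  then show ?thesis
    using padic_abs_frac[OF assms, of k 1] prime_gt_1_nat[OF assms] False
      power_eq_1_iff[of "real p" "multiplicity (int p) k"]
    by (auto simp: power_int_minus)
qed simp

lemma padic_abs_prime_powi:
  assumes "prime p" shows "padic_abs p (of_nat p powi k) = real p powi (- k)"
proof -
  have p1: "p > 1" using prime_gt_1_nat[OF assms] .
  have m: "multiplicity (int p) (int p ^ j) = j" for j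
    using p1 by (intro multiplicity_same_power) auto
  have e: "padic_abs p (of_nat p ^ j) = real p powi (- int j)" for j
    using padic_abs_frac[OF assms, of "int p ^ j" 1] p1 by (simp add: m)
  have e': "padic_abs p (inverse (of_nat p ^ j)) = real p powi (int j)" for j
    using padic_abs_frac[OF assms, of 1 "int p ^ j"] p1 by (simp add: m inverse_eq_divide)
  show ?thesis
  proof (cases "k \<ge> 0")
    case True
    then show ?thesis using e[of "nat k"] by (simp add: power_int_def)
  next
    case False
    then show ?thesis using e'[of "nat (- k)"] by (simp add: power_int_def power_inverse)
  qed
qed

lemma padic_abs_residue_unit:
  assumes p: "prime p" and q: "padic_abs p q \<le> 1"
  obtains d where "d < p" "padic_abs p (q - of_nat d) \<le> 1 / real p"
proof -
  obtain a b where ab: "quotient_of q = (a, b)" by (cases "quotient_of q") auto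
  have b: "b > 0" and cop: "coprime a b" and qeq: "q = of_int a / of_int b"
    using ab quotient_of_denom_pos quotient_of_coprime quotient_of_div by blast+
  have p1: "p > 1" using prime_gt_1_nat[OF p] .
  have bndvd: "\<not> int p dvd b"
  proof
    assume d: "int p dvd b"
    then have "\<not> int p dvd a"
      using cop p1 coprime_common_divisor[of a b "int p"] by auto
    then have "1 = padic_abs p (q * of_int b)"
      using padic_abs_of_int_eq_1_iff[OF p, of a] qeq b by simp
    also have "\<dots> \<le> padic_abs p (of_int b)"
      using q by (simp add: padic_abs_mult[OF p] mult_left_le_one_le)
    finally show False
      using d padic_abs_of_int_eq_1_iff[OF p, of b] padic_abs_of_int_le_1[OF p, of b] by simp
  qed
  then have "coprime b (int p)"
    using p by (metis coprime_commute prime_imp_coprime prime_nat_int_transfer)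
  then obtain x where x: "[b * x = 1] (mod int p)" using cong_solve_coprime_int by blast
  define d where "d = (a * x) mod int p"
  have d: "0 \<le> d" "d < int p" using p1 by (auto simp: d_def)
  have "[d * b = a * x * b] (mod int p)" by (intro cong_mult cong_refl) (simp add: d_def cong_def)
  also have "[a * x * b = a * 1] (mod int p)"
    using cong_mult[OF cong_refl x, of a] by (simp add: ac_simps)
  finally have "int p dvd a - d * b" by (simp add: cong_iff_dvd_diff dvd_diff_commute)
  then obtain c where c: "a - d * b = int p * c" by (auto elim: dvdE)
  have "padic_abs p (q - of_int d) = padic_abs p ((q - of_int d) * of_int b)"
    using padic_abs_of_int_eq_1_iff[OF p, of b] bndvd by (simp add: padic_abs_mult[OF p])
  also have "(q - of_int d) * of_int b = of_int (a - d * b)"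
    using b by (simp add: qeq field_simps)
  also have "\<dots> = of_nat p * of_int c" by (simp add: c)
  also have "padic_abs p (of_nat p * of_int c) \<le> padic_abs p (of_nat p) * 1"
    unfolding padic_abs_mult[OF p] by (intro mult_left_mono padic_abs_of_int_le_1 p) simp
  also have "padic_abs p (of_nat p) = 1 / real p"
    using padic_abs_prime_powi[OF p, of 1] by (simp add: power_int_minus inverse_eq_divide)
  finally show ?thesis using that[of "nat d"] d by simp
qed

lemma padic_abs_residue:
  assumes p: "prime p" and q: "padic_abs p q \<le> real p powi (n + 1)"
  obtains d where "d < p" "padic_abs p (q - of_nat d * of_nat p powi (- n - 1)) \<le> real p powi n"
proof -
  let ?u = "(of_nat p :: rat) powi (n + 1)" and ?v = "(of_nat p :: rat) powi (- n - 1)"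
  have p0: "real p > 0" "(of_nat p :: rat) \<noteq> 0" using prime_gt_0_nat[OF p] by auto
  have uv: "?u * ?v = 1" using p0 by (simp flip: power_int_add)
  have "padic_abs p (q * ?u) = padic_abs p q * real p powi (- n - 1)"
    by (simp add: padic_abs_mult[OF p] padic_abs_prime_powi[OF p])
  also have "\<dots> \<le> real p powi (n + 1) * real p powi (- n - 1)"
    using q p0 by (intro mult_right_mono) auto
  also have "\<dots> = 1" using p0 by (simp flip: power_int_add)
  finally obtain d where d: "d < p" "padic_abs p (q * ?u - of_nat d) \<le> 1 / real p"
    using padic_abs_residue_unit[OF p] by blast
  have "q - of_nat d * ?v = (q * ?u - of_nat d) * ?v"
    using uv by (simp add: algebra_simps)
  then have "padic_abs p (q - of_nat d * ?v) = padic_abs p (q * ?u - of_nat d) * real p powi (n + 1)"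
    using padic_abs_prime_powi[OF p, of "- n - 1"] by (simp add: padic_abs_mult[OF p] add.commute)
  also have "\<dots> \<le> 1 / real p * real p powi (n + 1)"
    using d p0 by (intro mult_right_mono) auto
  also have "\<dots> = real p powi n" using p0 by (simp add: power_int_add)
  finally show ?thesis using d that by blast
qed

lemma padic_ball_eq_cball: "padic_ball n = cball (0 :: 'p padic) (real CARD('p :: prime_card) powi n)"
  by (auto simp: padic_ball_def padic_norm_eq_dist dist_commute)

lemma padic_ball_borel [measurable, simp]: "padic_ball n \<in> sets borel"
  by (simp add: padic_ball_eq_cball)

lemma padic_ball_Suc:
  "padic_ball (n + 1) = (\<Union>d<CARD('p).
     (+) (padic_of_rat (of_nat d * of_nat CARD('p) powi (- n - 1))) ` (padic_ball n :: 'p :: prime_card padic set))"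
  (is "_ = (\<Union>d<_. (+) (?c d) ` _)")
proof (intro equalityI subsetI)
  let ?p = "real CARD('p)"
  have p1: "?p > 1" using prime_gt_1_nat[OF prime_card[where 'a='p]] by simp
  have mono: "?p powi n \<le> ?p powi (n + 1)" using p1 by (intro power_int_increasing) auto
  {
    fix x :: "'p padic" assume x: "x \<in> padic_ball (n + 1)"
    obtain q where q: "padic_norm (x - padic_of_rat q) < ?p powi n"
      using padic_of_rat_dense[of "?p powi n" x] p1 by auto
    have "padic_norm (padic_of_rat q :: 'p padic) \<le> ?p powi (n + 1)"
      using padic_norm_diff_le_max[of x "x - padic_of_rat q"] q mono x by (simp add: padic_ball_def)
    then obtain d where d: "d < CARD('p)"
      "padic_norm (padic_of_rat q - ?c d :: 'p padic) \<le> ?p powi n"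
      using padic_abs_residue[OF prime_card[where 'a='p], of q n]
      by (auto simp: padic_norm_of_rat simp flip: padic_of_rat_diff)
    have "padic_norm (x - ?c d) \<le> ?p powi n"
      using padic_norm_add_le_max[of "x - padic_of_rat q" "padic_of_rat q - ?c d"] d q by simp
    then show "x \<in> (\<Union>d<CARD('p). (+) (?c d) ` padic_ball n)"
      using d(1) by (auto simp: padic_ball_def intro!: bexI[of _ d] image_eqI[of _ _ "x - ?c d"])
  next
    fix x :: "'p padic" assume "x \<in> (\<Union>d<CARD('p). (+) (?c d) ` padic_ball n)"
    then obtain d y where dy: "x = ?c d + y" "padic_norm y \<le> ?p powi n"
      by (auto simp: padic_ball_def)
    have "padic_norm (?c d :: 'p padic) = padic_abs CARD('p) (of_int (int d)) * ?p powi (n + 1)"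
      by (simp add: padic_norm_of_rat padic_abs_mult[OF prime_card] padic_abs_prime_powi[OF prime_card] add.commute)
    also have "\<dots> \<le> 1 * ?p powi (n + 1)"
      by (intro mult_right_mono padic_abs_of_int_le_1 prime_card) auto
    finally show "x \<in> padic_ball (n + 1)"
      using dy mono padic_norm_add_le_max[of "?c d" y] by (simp add: padic_ball_def)
  }
qed

lemma padic_cosets_disjoint:
  "disjoint_family_on (\<lambda>d. (+) (padic_of_rat (of_nat d * of_nat CARD('p) powi (- n - 1)))
     ` (padic_ball n :: 'p :: prime_card padic set)) {..<CARD('p)}"
  (is "disjoint_family_on (\<lambda>d. (+) (?c d) ` _) _")
  unfolding disjoint_family_on_def
proof (intro ballI impI, rule ccontr)
  let ?p = "real CARD('p)"
  fix d e assume de: "d \<in> {..<CARD('p)}" "e \<in> {..<CARD('p)}" "d \<noteq> e"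
    and "(+) (?c d) ` (padic_ball n :: 'p padic set) \<inter> (+) (?c e) ` padic_ball n \<noteq> {}"
  then obtain x y :: "'p padic" where xy: "?c d + x = ?c e + y" "padic_norm x \<le> ?p powi n" "padic_norm y \<le> ?p powi n"
    by (auto simp: padic_ball_def)
  have p1: "?p > 1" using prime_gt_1_nat[OF prime_card[where 'a='p]] by simp
  have "?c d - ?c e = y - x" using xy(1) by (simp add: algebra_simps)
  then have le: "padic_norm (?c d - ?c e :: 'p padic) \<le> ?p powi n"
    using padic_norm_diff_le_max[of y x] xy by simp
  have "\<not> int CARD('p) dvd int d - int e"
    using de zdvd_imp_le[of "int CARD('p)" "\<bar>int d - int e\<bar>"] by auto
  then have "padic_abs CARD('p) (of_int (int d - int e)) = 1"
    by (simp only: padic_abs_of_int_eq_1_iff[OF prime_card] not_False_eq_True)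
  moreover have "of_nat d * of_nat CARD('p) powi (- n - 1) - of_nat e * of_nat CARD('p) powi (- n - 1)
      = (of_int (int d - int e) * of_nat CARD('p) powi (- n - 1) :: rat)"
    by (simp add: algebra_simps)
  ultimately have "padic_norm (?c d - ?c e :: 'p padic) = ?p powi (n + 1)"
    by (simp only: padic_norm_of_rat padic_abs_mult[OF prime_card]
        padic_abs_prime_powi[OF prime_card] flip: padic_of_rat_diff) (simp add: add.commute)
  moreover have "?p powi n < ?p powi (n + 1)" using p1 by (simp add: power_int_add)
  ultimately show False using le by simp
qed

lemma emeasure_padic_ball_Suc:
  fixes M :: "'p :: prime_card padic measure"
  assumes M: "is_padic_haar M"
  shows "emeasure M (padic_ball (n + 1)) = of_nat CARD('p) * emeasure M (padic_ball n)"
proof -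
  have sets: "sets M = sets borel"
    using M by (simp add: is_padic_haar_def)
  have inv: "emeasure M ((+) c ` A) = emeasure M A" if "A \<in> sets borel" for c A
    using M that by (auto simp: is_padic_haar_def)
  have im: "(+) c ` padic_ball n = cball c (real CARD('p) powi n)" for c :: "'p padic"
    by (auto simp: padic_ball_def dist_padic_def intro!: image_eqI[of _ _ "_ - c"])
      (metis minus_diff_eq padic_norm_minus)
  let ?c = "\<lambda>d. padic_of_rat (of_nat d * of_nat CARD('p) powi (- n - 1)) :: 'p padic"
  have "emeasure M (padic_ball (n + 1)) = (\<Sum>d<CARD('p). emeasure M ((+) (?c d) ` padic_ball n))"
    unfolding padic_ball_Suc
    by (rule sum_emeasure[symmetric, OF _ padic_cosets_disjoint]) (auto simp: sets im)
  then show ?thesis by (simp add: inv)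
qed

lemma emeasure_padic_ball:
  fixes M :: "'p :: prime_card padic measure"
  assumes M: "is_padic_haar M"
  shows "emeasure M (padic_ball n) = ennreal (real CARD('p) powr n)"
proof (induction n rule: int_induct[where k = 0])
  case base
  show ?case using M by (simp add: is_padic_haar_def padic_ball_def)
next
  case (step1 i)
  have "emeasure M (padic_ball (i + 1)) = of_nat CARD('p) * ennreal (real CARD('p) powr i)"
    using emeasure_padic_ball_Suc[OF M, of i] step1 by simp
  also have "\<dots> = ennreal (real CARD('p) * real CARD('p) powr i)"
    by (simp add: ennreal_mult ennreal_of_nat_eq_real_of_nat)
  finally show ?case by (simp add: powr_add mult.commute)
next
  case (step2 i)
  have "of_nat CARD('p) * emeasure M (padic_ball (i - 1)) = ennreal (real CARD('p) powr i)"
    using emeasure_padic_ball_Suc[OF M, of "i - 1"] step2 by simp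
  also have "\<dots> = ennreal (real CARD('p) * real CARD('p) powr (i - 1))"
    by (simp add: powr_diff)
  also have "\<dots> = of_nat CARD('p) * ennreal (real CARD('p) powr (i - 1))"
    by (simp add: ennreal_mult ennreal_of_nat_eq_real_of_nat)
  finally show ?case by (simp add: ennreal_mult_cancel_left)
qed

section \<open>Sums and integrals\<close>

lemma sum_power_abs_diff_le:
  fixes t :: real and F :: "int set"
  assumes t: "0 \<le> t" "t < 1" and F: "finite F"
  shows "(\<Sum>m\<in>F. t ^ nat \<bar>m - n\<bar>) \<le> 2 / (1 - t)"
proof -
  have half: "(\<Sum>m\<in>G. t ^ nat \<bar>m - n\<bar>) \<le> 1 / (1 - t)"
    if "finite G" "inj_on (\<lambda>m. nat \<bar>m - n\<bar>) G" for G
  proof -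
    have "(\<Sum>m\<in>G. t ^ nat \<bar>m - n\<bar>) = (\<Sum>j\<in>(\<lambda>m. nat \<bar>m - n\<bar>) ` G. t ^ j)"
      using that by (simp add: sum.reindex)
    also have "\<dots> \<le> (\<Sum>j. t ^ j)"
      using t that by (intro sum_le_suminf) (auto intro: summable_geometric)
    also have "\<dots> = 1 / (1 - t)" using t by (intro suminf_geometric) auto
    finally show ?thesis .
  qed
  have "F = {m\<in>F. n \<le> m} \<union> {m\<in>F. m < n}" by auto
  then have "(\<Sum>m\<in>F. t ^ nat \<bar>m - n\<bar>)
      = (\<Sum>m\<in>{m\<in>F. n \<le> m}. t ^ nat \<bar>m - n\<bar>) + (\<Sum>m\<in>{m\<in>F. m < n}. t ^ nat \<bar>m - n\<bar>)"
    using F by (subst sum.union_disjoint[symmetric]) auto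
  also have "\<dots> \<le> 1 / (1 - t) + 1 / (1 - t)"
    using F by (intro add_mono half) (auto simp: inj_on_def)
  finally show ?thesis by simp
qed

lemma nn_integral_sums_le:
  fixes f :: "'a \<Rightarrow> 'b :: {banach, second_countable_topology}"
  assumes g [measurable]: "\<And>k. g k \<in> borel_measurable M"
    and sums: "AE x in M. (\<lambda>k. g k x) sums f x"
  shows "(\<integral>\<^sup>+x. norm (f x) \<partial>M) \<le> (\<Sum>k. \<integral>\<^sup>+x. norm (g k x) \<partial>M)"
proof -
  have "(\<integral>\<^sup>+x. norm (f x) \<partial>M) \<le> (\<integral>\<^sup>+x. (\<Sum>k. ennreal (norm (g k x))) \<partial>M)"
  proof (rule nn_integral_mono_AE, use sums in eventually_elim)
    case (elim x)
    then have "(\<lambda>N. ennreal (norm (\<Sum>k<N. g k x))) \<longlonglongrightarrow> ennreal (norm (f x))"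
      unfolding sums_def by (intro tendsto_ennrealI tendsto_norm)
    then show ?case
    proof (rule LIMSEQ_le_const2, intro exI allI impI)
      fix N
      have "ennreal (norm (\<Sum>k<N. g k x)) \<le> (\<Sum>k<N. ennreal (norm (g k x)))"
        by (simp add: sum_ennreal norm_sum ennreal_leI)
      also have "\<dots> \<le> (\<Sum>k. ennreal (norm (g k x)))" by (intro sum_le_suminf) auto
      finally show "ennreal (norm (\<Sum>k<N. g k x)) \<le> (\<Sum>k. ennreal (norm (g k x)))" .
    qed
  qed
  also have "\<dots> = (\<Sum>k. \<integral>\<^sup>+x. norm (g k x) \<partial>M)" by (intro nn_integral_suminf) simp
  finally show ?thesis .
qed

section \<open>Integrals of blocks over balls\<close>

lemma prime_card_gt_1: "real CARD('p :: prime_card) > 1"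
  using prime_gt_1_nat[OF prime_card[where 'a='p]] by simp

lemma padic_ball_eq_powr:
  "padic_ball n = {x :: 'p padic. padic_norm x \<le> real CARD('p :: prime_card) powr n}"
  using prime_card_gt_1[where 'p='p] by (simp add: padic_ball_def powr_real_of_int')

lemma sets_padic_haar: "is_padic_haar M \<Longrightarrow> sets M = sets borel"
  by (simp add: is_padic_haar_def)

lemma measure_padic_ball:
  "is_padic_haar M \<Longrightarrow> measure M (padic_ball n :: 'p padic set) = real CARD('p :: prime_card) powr n"
  by (simp add: measure_def emeasure_padic_ball)

lemma nn_integral_block_padic_ball:
  fixes M :: "'p :: prime_card padic measure" and r \<alpha> :: real
  assumes M: "is_padic_haar M" and r: "1 < r" and \<alpha>: "0 < \<alpha>" "1 / r + \<alpha> < 1"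
    and a: "in_Lr M r a" and supp: "{x. a x \<noteq> 0} \<subseteq> padic_ball n"
    and norm: "Lr_norm M r a \<le> measure M (padic_ball n :: 'p padic set) powr (- \<alpha>)"
  shows "(\<integral>\<^sup>+x. norm (indicator (padic_ball m) x * a x) \<partial>M)
    \<le> ennreal (2 * real CARD('p) powr (m * (1 - 1 / r - \<alpha>))
        * (real CARD('p) powr - min \<alpha> (1 - 1 / r - \<alpha>)) ^ nat \<bar>m - n\<bar>)"
proof -
  define q where "q = real CARD('p)"
  have q: "q > 1" unfolding q_def by (rule prime_card_gt_1)
  define b where "b = min m n"
  define A where "A = q powr (- \<alpha> * n - b / r)"
  have A: "A > 0" using q by (simp add: A_def)
  define I where "I = (LINT x|M. norm (a x) powr r)"
  have am [measurable]: "a \<in> borel_measurable M" and int: "integrable M (\<lambda>x. norm (a x) powr r)"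
    using a by (auto simp: in_Lr_def)
  have [measurable]: "padic_ball k \<in> sets M" for k :: int
    by (simp add: sets_padic_haar[OF M])
  have I0: "I \<ge> 0" unfolding I_def by (intro Bochner_Integration.integral_nonneg) auto
  have "I = (I powr (1 / r)) powr r" using r I0 by (simp add: powr_powr)
  also have "\<dots> \<le> (q powr (- \<alpha> * n)) powr r"
    using norm r by (intro powr_mono2)
      (auto simp: Lr_norm_def I_def measure_padic_ball[OF M] q_def powr_powr mult.commute)
  finally have I: "I \<le> q powr (- \<alpha> * n * r)" by (simp add: powr_powr)
  \<comment> \<open>Replaces Hoelder's inequality; \<open>A\<close> balances the integrals of the two terms.\<close>
  have pw: "norm (indicator (padic_ball m) x * a x)
      \<le> A * indicator (padic_ball b) x + A powr (1 - r) * norm (a x) powr r" for x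
  proof (cases "x \<in> padic_ball m \<and> x \<in> padic_ball n")
    case False
    then have 0: "norm (indicator (padic_ball m) x * a x) = 0" using supp by (auto simp: indicator_def)
    show ?thesis unfolding 0 using A by simp
  next
    case True
    then have xb: "x \<in> padic_ball b" by (simp add: b_def min_def)
    show ?thesis
    proof (cases "norm (a x) \<le> A")
      case True
      then show ?thesis using xb A by (auto simp: indicator_def intro: add_increasing2 add_nonneg_nonneg)
    next
      case False
      have "norm (a x) = norm (a x) powr (1 - r) * norm (a x) powr r"
        using False A by (simp flip: powr_add)
      also have "\<dots> \<le> A powr (1 - r) * norm (a x) powr r"
        using False A r by (intro mult_right_mono powr_mono2') auto
      finally show ?thesis using A by (auto simp: indicator_def)
    qed
  qed
  have "(\<integral>\<^sup>+x. norm (indicator (padic_ball m) x * a x) \<partial>M)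
      \<le> (\<integral>\<^sup>+x. ennreal (A * indicator (padic_ball b) x) + ennreal (A powr (1 - r)) * ennreal (norm (a x) powr r) \<partial>M)"
    using pw A by (intro nn_integral_mono) (simp flip: ennreal_plus ennreal_mult)
  also have "\<dots> = (\<integral>\<^sup>+x. ennreal (A * indicator (padic_ball b) x) \<partial>M)
      + ennreal (A powr (1 - r)) * (\<integral>\<^sup>+x. ennreal (norm (a x) powr r) \<partial>M)"
    by (subst nn_integral_add) (auto simp: nn_integral_cmult)
  also have "(\<integral>\<^sup>+x. ennreal (A * indicator (padic_ball b) x) \<partial>M) = ennreal (A * q powr b)"
    using A by (simp add: ennreal_mult' ennreal_indicator nn_integral_cmult emeasure_padic_ball[OF M] q_def)
  also have "(\<integral>\<^sup>+x. ennreal (norm (a x) powr r) \<partial>M) = ennreal I"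
    unfolding I_def using int by (intro nn_integral_eq_integral) auto
  also have "ennreal (A * q powr b) + ennreal (A powr (1 - r)) * ennreal I
      = ennreal (A * q powr b + A powr (1 - r) * I)"
    using A I0 by (simp add: ennreal_mult)
  also have "\<dots> \<le> ennreal (A * q powr b + A powr (1 - r) * q powr (- \<alpha> * n * r))"
    using I A by (intro ennreal_leI add_mono mult_left_mono) auto
  also have "A * q powr b = q powr (b * (1 - 1 / r) - \<alpha> * n)"
    by (simp add: A_def algebra_simps flip: powr_add)
  also have "A powr (1 - r) * q powr (- \<alpha> * n * r) = q powr (b * (1 - 1 / r) - \<alpha> * n)"
    using r by (simp add: A_def powr_powr field_simps flip: powr_add)
  also have "q powr (b * (1 - 1 / r) - \<alpha> * n) + q powr (b * (1 - 1 / r) - \<alpha> * n)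
     \<le> 2 * q powr (m * (1 - 1 / r - \<alpha>) + - min \<alpha> (1 - 1 / r - \<alpha>) * real (nat \<bar>m - n\<bar>))"
  proof -
    have "b * (1 - 1 / r) - \<alpha> * n \<le> m * (1 - 1 / r - \<alpha>) + - min \<alpha> (1 - 1 / r - \<alpha>) * real (nat \<bar>m - n\<bar>)"
    proof (cases "m \<le> n")
      case True
      have "min \<alpha> (1 - 1 / r - \<alpha>) * (n - m) \<le> \<alpha> * (n - m)"
        using True by (intro mult_right_mono) auto
      then show ?thesis using True by (simp add: b_def algebra_simps)
    next
      case False
      have "min \<alpha> (1 - 1 / r - \<alpha>) * (m - n) \<le> (1 - 1 / r - \<alpha>) * (m - n)"
        using False by (intro mult_right_mono) auto
      then show ?thesis using False by (simp add: b_def algebra_simps)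
    qed
    then show ?thesis using q by (simp add: powr_mono)
  qed
  also have "2 * q powr (m * (1 - 1 / r - \<alpha>) + - min \<alpha> (1 - 1 / r - \<alpha>) * real (nat \<bar>m - n\<bar>))
     = 2 * q powr (m * (1 - 1 / r - \<alpha>)) * (q powr - min \<alpha> (1 - 1 / r - \<alpha>)) ^ nat \<bar>m - n\<bar>"
    unfolding powr_add using q by (simp add: powr_powr flip: powr_realpow)
  finally show ?thesis by (simp add: q_def ennreal_leI)
qed

lemma nn_integral_block_decomp_padic_ball:
  fixes M :: "'p :: prime_card padic measure" and r \<alpha> :: real
  assumes M: "is_padic_haar M" and r: "1 < r" and \<alpha>: "0 < \<alpha>" "1 / r + \<alpha> < 1"
    and f: "block_decomp M r \<alpha> f l a"
  obtains n :: "nat \<Rightarrow> int" where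
    "\<And>m. (\<integral>\<^sup>+x. norm (indicator (padic_ball m) x * f x) \<partial>M)
      \<le> ennreal (2 * real CARD('p) powr (m * (1 - 1 / r - \<alpha>))
          * (\<Sum>k. norm (l k) * (real CARD('p) powr - min \<alpha> (1 - 1 / r - \<alpha>)) ^ nat \<bar>m - n k\<bar>))"
proof -
  define t where "t = real CARD('p) powr - min \<alpha> (1 - 1 / r - \<alpha>)"
  have t: "0 \<le> t" "t < 1"
    using prime_card_gt_1[where 'p='p] \<alpha> by (auto simp: t_def intro!: powr_less_one)
  have l: "summable (\<lambda>k. norm (l k))"
    and a: "central_block M r \<alpha> (a k)"
    and sums: "AE x in M. (\<lambda>k. l k * a k x) sums f x" for k
    using f by (auto simp: block_decomp_def)
  have [measurable]: "a k \<in> borel_measurable M" for k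
    using a[of k] by (simp add: central_block_def in_Lr_def)
  have [measurable]: "padic_ball k \<in> sets M" for k :: int
    by (simp add: sets_padic_haar[OF M])
  obtain n where n: "\<And>k. {x. a k x \<noteq> 0} \<subseteq> padic_ball (n k)"
    "\<And>k. Lr_norm M r (a k) \<le> measure M (padic_ball (n k) :: 'p padic set) powr (- \<alpha>)"
    using a unfolding central_block_def by metis
  show ?thesis
  proof (rule that[of n])
    fix m :: int
    let ?c = "2 * real CARD('p) powr (m * (1 - 1 / r - \<alpha>))"
    have sm: "summable (\<lambda>k. norm (l k) * t ^ nat \<bar>m - n k\<bar>)"
      using t by (intro summable_comparison_test'[OF l]) (auto intro!: mult_left_le power_le_one simp: abs_mult)
    have "(\<integral>\<^sup>+x. norm (indicator (padic_ball m) x * f x) \<partial>M)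
       \<le> (\<Sum>k. \<integral>\<^sup>+x. norm (indicator (padic_ball m) x * (l k * a k x)) \<partial>M)"
    proof (rule nn_integral_sums_le)
      show "AE x in M. (\<lambda>k. indicator (padic_ball m) x * (l k * a k x)) sums (indicator (padic_ball m) x * f x)"
        using sums by eventually_elim (rule sums_mult)
    qed simp
    also have "\<dots> \<le> (\<Sum>k. ennreal (?c * (norm (l k) * t ^ nat \<bar>m - n k\<bar>)))"
    proof (intro suminf_le allI)
      fix k
      have "(\<integral>\<^sup>+x. norm (indicator (padic_ball m) x * (l k * a k x)) \<partial>M)
          = ennreal (norm (l k)) * (\<integral>\<^sup>+x. norm (indicator (padic_ball m) x * a k x) \<partial>M)"
        by (subst nn_integral_cmult[symmetric])
          (auto simp: norm_mult ac_simps simp flip: ennreal_mult)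
      also have "\<dots> \<le> ennreal (norm (l k)) * ennreal (?c * t ^ nat \<bar>m - n k\<bar>)"
        unfolding t_def using a[of k] n
        by (intro mult_left_mono nn_integral_block_padic_ball M r \<alpha>) (auto simp: central_block_def)
      also have "\<dots> = ennreal (?c * (norm (l k) * t ^ nat \<bar>m - n k\<bar>))"
        using t by (simp add: ac_simps flip: ennreal_mult)
      finally show "(\<integral>\<^sup>+x. norm (indicator (padic_ball m) x * (l k * a k x)) \<partial>M)
          \<le> ennreal (?c * (norm (l k) * t ^ nat \<bar>m - n k\<bar>))" .
    qed auto
    also have "\<dots> = ennreal (?c * (\<Sum>k. norm (l k) * t ^ nat \<bar>m - n k\<bar>))"
      using t sm by (subst suminf_ennreal2) (auto simp: suminf_mult intro!: summable_mult)
    finally show "(\<integral>\<^sup>+x. norm (indicator (padic_ball m) x * f x) \<partial>M)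
      \<le> ennreal (?c * (\<Sum>k. norm (l k) * (real CARD('p) powr - min \<alpha> (1 - 1 / r - \<alpha>)) ^ nat \<bar>m - n k\<bar>))"
      by (simp add: t_def)
  qed
qed

section \<open>The Hardy operator\<close>

lemma sphere_0_borel [measurable, simp]: "sphere (0 :: 'p :: prime_card padic) e \<in> sets borel"
proof -
  have "sphere (0 :: 'p padic) e = cball 0 e - ball 0 e" by auto
  then show ?thesis by simp
qed

lemma mem_sphere_powr_iff:
  "x \<in> sphere 0 (real CARD('p) powr i) \<Longrightarrow>
   x \<in> sphere (0 :: 'p :: prime_card padic) (real CARD('p) powr j) \<longleftrightarrow> real_of_int i = j"
  using prime_card_gt_1[where 'p='p] by (auto simp: powr_inj)

lemma central_block_sphere:
  fixes M :: "'p :: prime_card padic measure" and r \<alpha> :: real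
  assumes M: "is_padic_haar M" and r: "1 < r"
  shows "central_block M r \<alpha>
    (\<lambda>x. indicator (sphere 0 (real CARD('p) powr m)) x * complex_of_real (real CARD('p) powr (- (m :: int) * (1 / r + \<alpha>))))"
    (is "central_block M r \<alpha> ?a")
proof -
  define q where "q = real CARD('p)"
  have q: "q > 1" unfolding q_def by (rule prime_card_gt_1)
  define S where "S = sphere (0 :: 'p padic) (q powr m)"
  define c where "c = q powr (- m * (1 / r + \<alpha>))"
  have a: "?a = (\<lambda>x. indicator S x * complex_of_real c)" by (simp add: S_def c_def q_def)
  have Sm [measurable]: "S \<in> sets M" by (simp add: sets_padic_haar[OF M] S_def)
  have Bm: "padic_ball m \<in> sets M" by (simp add: sets_padic_haar[OF M])
  have sub: "S \<subseteq> padic_ball m"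
    by (auto simp: S_def padic_ball_eq_powr q_def padic_norm_eq_dist dist_commute)
  have SB: "emeasure M S \<le> ennreal (q powr m)"
    using emeasure_mono[OF sub Bm] by (simp add: emeasure_padic_ball[OF M] q_def)
  then have fin: "emeasure M S < \<infinity>" by (rule order.strict_trans1) simp
  have mS: "measure M S \<le> q powr m"
    using SB unfolding measure_def by (intro enn2real_leI) auto
  have pw: "norm (indicator S x * complex_of_real c) powr r = indicator S x * c powr r" for x
    by (auto simp: indicator_def c_def)
  have "Lr_norm M r ?a = (measure M S * c powr r) powr (1 / r)"
    unfolding a Lr_norm_def pw using Sm sets.sets_into_space[OF Sm] by (simp add: Int_absorb2)
  also have "\<dots> \<le> (q powr m * c powr r) powr (1 / r)"
    using mS r by (intro powr_mono2 mult_right_mono) auto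
  also have "\<dots> = (q powr m) powr - \<alpha>"
    using r by (simp add: c_def powr_powr field_simps flip: powr_add)
  finally have "Lr_norm M r ?a \<le> measure M (padic_ball m :: 'p padic set) powr - \<alpha>"
    by (simp add: measure_padic_ball[OF M] q_def)
  moreover have "in_Lr M r ?a"
    unfolding a in_Lr_def pw using fin by auto
  moreover have "{x. ?a x \<noteq> 0} \<subseteq> padic_ball m"
    using sub by (intro order_trans[OF _ sub]) (auto simp: S_def q_def indicator_def split: if_splits)
  ultimately show ?thesis by (auto simp: central_block_def)
qed

lemma indicator_scaleR_eq_mult: "indicator A x *\<^sub>R z = indicator A x * (z :: complex)"
  by (simp add: indicator_def)

lemma set_integrable_padic_ball:
  fixes M :: "'p :: prime_card padic measure" and r \<alpha> :: real
  assumes M: "is_padic_haar M" and r: "1 < r" and \<alpha>: "0 < \<alpha>" "1 / r + \<alpha> < 1"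
    and f: "f \<in> block_space M r \<alpha>"
  shows "set_integrable M (padic_ball m) f"
proof -
  obtain l a where la: "block_decomp M r \<alpha> f l a" using f by (auto simp: block_space_def)
  have [measurable]: "f \<in> borel_measurable M"
    using f by (auto simp: block_space_def in_Lr_loc_def)
  have [measurable]: "padic_ball m \<in> sets M"
    by (simp add: sets_padic_haar[OF M])
  have "integrable M (\<lambda>x. indicator (padic_ball m) x * f x)"
  proof (rule integrableI_bounded)
    show "(\<integral>\<^sup>+x. norm (indicator (padic_ball m) x * f x) \<partial>M) < \<infinity>"
      by (rule nn_integral_block_decomp_padic_ball[OF M r \<alpha> la], erule meta_allE, erule order.strict_trans1) simp
  qed simp
  then show ?thesis
    by (simp add: set_integrable_def indicator_scaleR_eq_mult)
qed

lemma padic_norm_le_eq_padic_ball: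
  fixes x :: "'p :: prime_card padic"
  assumes "padic_norm x = real CARD('p) powr m"
  shows "{y. padic_norm y \<le> padic_norm x} = (padic_ball m :: 'p padic set)"
  by (simp add: padic_ball_eq_powr assms)

lemma padic_norm_values_powr:
  fixes x :: "'p :: prime_card padic"
  assumes "x \<noteq> 0"
  obtains n :: int where "padic_norm x = real CARD('p) powr n"
  using padic_norm_values[OF assms] prime_card_gt_1[where 'p='p]
  by (metis powr_real_of_int' less_imp_le not_one_less_zero of_nat_0_le_iff)

lemma padic_hardy_sums:
  fixes M :: "'p :: prime_card padic measure" and f :: "'p padic \<Rightarrow> complex" and c :: real
  shows "(\<lambda>k. ((LINT y:padic_ball (int_decode k)|M. f y)
        * complex_of_real (real CARD('p) powr (int_decode k * (c - 1))))
      * (indicator (sphere 0 (real CARD('p) powr int_decode k)) x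
        * complex_of_real (real CARD('p) powr (- int_decode k * c))))
    sums padic_hardy M f x" (is "?g sums _")
proof (cases "x = 0")
  case True
  then show ?thesis using prime_card_gt_1[where 'p='p] by (simp add: padic_hardy_def padic_norm_eq_dist)
next
  case False
  then obtain m :: int where m: "padic_norm x = real CARD('p) powr m" by (rule padic_norm_values_powr)
  have xm: "x \<in> sphere 0 (real CARD('p) powr m)"
    using m by (simp add: padic_norm_eq_dist dist_commute)
  have "?g k = 0" if "k \<noteq> int_encode m" for k
    using that mem_sphere_powr_iff[OF xm, of "int_decode k"] by (auto simp: indicator_def)
  then have "?g sums (\<Sum>k\<in>{int_encode m}. ?g k)"
    by (intro sums_finite) auto
  also have "(\<Sum>k\<in>{int_encode m}. ?g k)
      = (LINT y:padic_ball m|M. f y) * complex_of_real (real CARD('p) powr - m)"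
    using xm by (simp add: algebra_simps del: mem_sphere_0 mem_sphere flip: of_real_mult powr_add)
  also have "\<dots> = padic_hardy M f x"
    unfolding padic_hardy_def padic_norm_le_eq_padic_ball[OF m] unfolding m by (simp add: powr_minus divide_inverse)
  finally show ?thesis .
qed

lemma borel_measurable_padic_hardy:
  fixes M :: "'p :: prime_card padic measure" and f :: "'p padic \<Rightarrow> complex"
  assumes M: "is_padic_haar M"
  shows "padic_hardy M f \<in> borel_measurable M"
proof -
  have [measurable]: "sphere (0 :: 'p padic) e \<in> sets M" for e
    by (simp add: sets_padic_haar[OF M])
  have eq: "padic_hardy M f = (\<lambda>x. \<Sum>k. ((LINT y:padic_ball (int_decode k)|M. f y)
        * complex_of_real (real CARD('p) powr (int_decode k * ((0 :: real) - 1))))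
      * (indicator (sphere 0 (real CARD('p) powr int_decode k)) x
        * complex_of_real (real CARD('p) powr (- int_decode k * (0 :: real)))))"
    by (intro ext sums_unique padic_hardy_sums)
  show ?thesis unfolding eq by (intro borel_measurable_suminf) simp
qed

lemma in_Lr_loc_padic_hardy:
  fixes M :: "'p :: prime_card padic measure" and r \<alpha> :: real
  assumes M: "is_padic_haar M" and r: "1 < r" and \<alpha>: "0 < \<alpha>" "1 / r + \<alpha> < 1"
    and f: "f \<in> block_space M r \<alpha>"
  shows "in_Lr_loc M r (padic_hardy M f)"
  unfolding in_Lr_loc_def
proof (intro conjI allI impI borel_measurable_padic_hardy[OF M])
  fix K :: "'p padic set" assume K: "compact K \<and> 0 \<notin> K"
  have [measurable]: "padic_hardy M f \<in> borel_measurable M" by (rule borel_measurable_padic_hardy[OF M])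
  have [measurable]: "K \<in> sets M" "padic_ball k \<in> sets M" for k :: int
    using K by (auto simp: sets_padic_haar[OF M] compact_imp_closed)
  obtain e where e: "e > 0" "\<And>x. x \<in> K \<Longrightarrow> e \<le> padic_norm x"
  proof -
    have "open (- K)" "0 \<in> - K" using K compact_imp_closed by auto
    then obtain e where "e > 0" "ball 0 e \<subseteq> - K" by (meson open_contains_ball)
    then show ?thesis using that[of e] by (force simp: padic_norm_eq_dist dist_commute)
  qed
  obtain R where R: "\<And>x. x \<in> K \<Longrightarrow> padic_norm x \<le> R"
    using compact_imp_bounded[of K] K bounded_any_center[of K 0]
    by (auto simp: padic_norm_eq_dist dist_commute)
  obtain N where N: "R < real CARD('p) ^ N"
    using real_arch_pow[OF prime_card_gt_1[where 'p='p]] by blast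
  have KN: "padic_norm x \<le> real CARD('p) powr (int N)" if "x \<in> K" for x
    using R[OF that] N prime_card_gt_1[where 'p='p] by (simp add: powr_realpow)
  define B where "B = (LINT y:padic_ball (int N)|M. norm (f y)) / e"
  have bound: "norm (padic_hardy M f x) \<le> B" if x: "x \<in> K" for x
  proof -
    have x0: "x \<noteq> 0" using K x by auto
    obtain m :: int where m: "padic_norm x = real CARD('p) powr m"
      using padic_norm_values_powr[OF x0] .
    have sub: "padic_ball m \<subseteq> (padic_ball (int N) :: 'p padic set)"
      using KN[OF x] unfolding m padic_ball_eq_powr by auto
    have "norm (LINT y:padic_ball m|M. f y) \<le> (LINT y:padic_ball m|M. norm (f y))"
      by (intro set_integral_norm_bound set_integrable_padic_ball[OF M r \<alpha> f])
    also have "\<dots> \<le> (LINT y:padic_ball (int N)|M. norm (f y))"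
      using set_integrable_norm[OF set_integrable_padic_ball[OF M r \<alpha> f]] sub
      unfolding set_lebesgue_integral_def set_integrable_def
      by (intro integral_mono) (auto simp: indicator_def)
    finally have "norm (LINT y:padic_ball m|M. f y) \<le> (LINT y:padic_ball (int N)|M. norm (f y))" .
    then have "norm (LINT y:padic_ball m|M. f y) / padic_norm x \<le> B"
      unfolding B_def using e x by (intro frac_le) (auto intro: order_trans[OF norm_ge_zero])
    then show ?thesis
      by (simp add: padic_hardy_def norm_divide padic_norm_le_eq_padic_ball[OF m])
  qed
  show "in_Lr M r (\<lambda>x. indicator K x * padic_hardy M f x)"
    unfolding in_Lr_def
  proof
    have "integrable M (\<lambda>x. B powr r * indicator (padic_ball (int N)) x :: real)"
      by (intro integrable_mult_right integrable_real_indicator) (auto simp: emeasure_padic_ball[OF M])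
    then show "integrable M (\<lambda>x. norm (indicator K x * padic_hardy M f x) powr r)"
    proof (rule Bochner_Integration.integrable_bound)
      show "AE x in M. norm (norm (indicator K x * padic_hardy M f x) powr r)
          \<le> norm (B powr r * indicator (padic_ball (int N)) x)"
        using bound KN r by (intro AE_I2) (auto simp: indicator_def padic_ball_eq_powr intro: powr_mono2)
    qed simp
  qed simp
qed

lemma block_decomp_padic_hardy:
  fixes M :: "'p :: prime_card padic measure" and r \<alpha> :: real
  assumes M: "is_padic_haar M" and r: "1 < r" and \<alpha>: "0 < \<alpha>" "1 / r + \<alpha> < 1"
    and f: "f \<in> block_space M r \<alpha>" and la: "block_decomp M r \<alpha> f l a"
  obtains l' a' where "block_decomp M r \<alpha> (padic_hardy M f) l' a'"
    "(\<Sum>k. norm (l' k)) \<le> 4 / (1 - real CARD('p) powr - min \<alpha> (1 - 1 / r - \<alpha>)) * (\<Sum>k. norm (l k))"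
proof -
  define q where "q = real CARD('p)"
  have q: "q > 1" unfolding q_def by (rule prime_card_gt_1)
  define t where "t = q powr - min \<alpha> (1 - 1 / r - \<alpha>)"
  have t: "0 \<le> t" "t < 1"
    using q \<alpha> by (auto simp: t_def intro!: powr_less_one)
  define l' where "l' k = (LINT y:padic_ball (int_decode k)|M. f y)
    * complex_of_real (q powr (int_decode k * (1 / r + \<alpha> - 1)))" for k
  define a' where "a' k x = indicator (sphere 0 (q powr int_decode k)) x
    * complex_of_real (q powr (- int_decode k * (1 / r + \<alpha>)))" for k and x :: "'p padic"
  obtain n :: "nat \<Rightarrow> int" where n: "\<And>m. (\<integral>\<^sup>+x. norm (indicator (padic_ball m) x * f x) \<partial>M)
      \<le> ennreal (2 * q powr (m * (1 - 1 / r - \<alpha>)) * (\<Sum>k. norm (l k) * t ^ nat \<bar>m - n k\<bar>))"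
    using nn_integral_block_decomp_padic_ball[OF M r \<alpha> la] unfolding q_def t_def by blast
  have l: "summable (\<lambda>k. norm (l k))" using la by (simp add: block_decomp_def)
  have sm: "summable (\<lambda>k. norm (l k) * t ^ nat \<bar>m - n k\<bar>)" for m
    using t by (intro summable_comparison_test'[OF l]) (auto intro!: mult_left_le power_le_one simp: abs_mult)
  have l': "norm (l' k) \<le> 2 * (\<Sum>i. norm (l i) * t ^ nat \<bar>int_decode k - n i\<bar>)" for k
  proof -
    define m where "m = int_decode k"
    let ?s = "\<Sum>i. norm (l i) * t ^ nat \<bar>m - n i\<bar>"
    have "ennreal (norm (LINT y:padic_ball m|M. f y)) \<le> (\<integral>\<^sup>+x. norm (indicator (padic_ball m) x * f x) \<partial>M)"
      using set_integrable_padic_ball[OF M r \<alpha> f, of m]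
      unfolding set_lebesgue_integral_def set_integrable_def indicator_scaleR_eq_mult by (rule integral_norm_bound_ennreal)
    also note n
    finally have "norm (LINT y:padic_ball m|M. f y) \<le> 2 * q powr (m * (1 - 1 / r - \<alpha>)) * ?s"
      using t by (subst (asm) ennreal_le_iff) (auto intro!: mult_nonneg_nonneg suminf_nonneg sm)
    then have "norm (l' k) \<le> (2 * q powr (m * (1 - 1 / r - \<alpha>)) * ?s) * q powr (m * (1 / r + \<alpha> - 1))"
      by (simp add: l'_def m_def norm_mult mult_right_mono)
    also have "\<dots> = 2 * ?s * (q powr (m * (1 - 1 / r - \<alpha>)) * q powr (m * (1 / r + \<alpha> - 1)))"
      by (simp only: ac_simps)
    also have "q powr (m * (1 - 1 / r - \<alpha>)) * q powr (m * (1 / r + \<alpha> - 1)) = 1"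
      using q by (simp add: algebra_simps flip: powr_add)
    finally show ?thesis by (simp add: m_def)
  qed
  have part: "(\<Sum>k<K. norm (l' k)) \<le> 4 / (1 - t) * (\<Sum>k. norm (l k))" for K
  proof -
    have "(\<Sum>k<K. norm (l' k)) \<le> (\<Sum>k<K. 2 * (\<Sum>i. norm (l i) * t ^ nat \<bar>int_decode k - n i\<bar>))"
      by (intro sum_mono l')
    also have "\<dots> = 2 * (\<Sum>i. \<Sum>k<K. norm (l i) * t ^ nat \<bar>int_decode k - n i\<bar>)"
      by (simp only: suminf_sum[OF sm] sum_distrib_left)
    also have "(\<Sum>i. \<Sum>k<K. norm (l i) * t ^ nat \<bar>int_decode k - n i\<bar>) \<le> (\<Sum>i. norm (l i) * (2 / (1 - t)))"
    proof (intro suminf_le summable_sum sm summable_mult2 l)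
      fix i
      have "(\<Sum>k<K. t ^ nat \<bar>int_decode k - n i\<bar>) = (\<Sum>m\<in>int_decode ` {..<K}. t ^ nat \<bar>m - n i\<bar>)"
        by (simp add: sum.reindex inj_int_decode)
      also have "\<dots> \<le> 2 / (1 - t)" using t by (intro sum_power_abs_diff_le) auto
      finally show "(\<Sum>k<K. norm (l i) * t ^ nat \<bar>int_decode k - n i\<bar>) \<le> norm (l i) * (2 / (1 - t))"
        unfolding sum_distrib_left[symmetric] by (rule mult_left_mono) simp
    qed
    also have "\<dots> = (\<Sum>i. norm (l i)) * (2 / (1 - t))"
      by (rule suminf_mult2[OF l, symmetric])
    finally show ?thesis by simp
  qed
  have suml': "summable (\<lambda>k. norm (l' k))"
    by (rule bounded_imp_summable[where B = "4 / (1 - t) * (\<Sum>k. norm (l k))"])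
      (simp_all only: norm_ge_zero part flip: lessThan_Suc_atMost)
  show ?thesis
  proof (rule that[of l' a'])
    show "block_decomp M r \<alpha> (padic_hardy M f) l' a'"
      unfolding block_decomp_def
    proof (intro conjI allI AE_I2 suml')
      show "central_block M r \<alpha> (a' k)" for k
        unfolding a'_def q_def by (rule central_block_sphere[OF M r])
      show "(\<lambda>k. l' k * a' k x) sums padic_hardy M f x" for x
        unfolding l'_def a'_def q_def by (rule padic_hardy_sums)
    qed
    show "(\<Sum>k. norm (l' k)) \<le> 4 / (1 - real CARD('p) powr - min \<alpha> (1 - 1 / r - \<alpha>)) * (\<Sum>k. norm (l k))"
      using suminf_le_const[OF suml' part] unfolding t_def q_def .
  qed
qed

theorem theorem3p4:
  fixes M :: "'p :: prime_card padic measure" and r \<alpha> :: real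
  assumes "is_padic_haar M"
    and "1 < r" and "0 < \<alpha>"
    and "0 < 1 / r + \<alpha>" and "1 / r + \<alpha> < 1"
  shows "\<exists>C>0. \<forall>f\<in>block_space M r \<alpha>.
    (\<forall>x :: 'p padic. x \<noteq> 0 \<longrightarrow> set_integrable M {y. padic_norm y \<le> padic_norm x} f) \<and>
    padic_hardy M f \<in> block_space M r \<alpha> \<and>
    block_norm M r \<alpha> (padic_hardy M f) \<le> C * block_norm M r \<alpha> f"
proof (intro exI[of _ "4 / (1 - real CARD('p) powr - min \<alpha> (1 - 1 / r - \<alpha>))"] conjI ballI allI impI)
  let ?C = "4 / (1 - real CARD('p) powr - min \<alpha> (1 - 1 / r - \<alpha>))"
  note asm = assms(1,2,3,5)
  show C: "?C > 0"
    using prime_card_gt_1[where 'p='p] assms by (auto intro!: powr_less_one)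
  fix f assume f: "f \<in> block_space M r \<alpha>"
  {
    fix x :: "'p padic" assume "x \<noteq> 0"
    then obtain m :: int where m: "padic_norm x = real CARD('p) powr m" by (rule padic_norm_values_powr)
    show "set_integrable M {y. padic_norm y \<le> padic_norm x} f"
      unfolding padic_norm_le_eq_padic_ball[OF m] by (rule set_integrable_padic_ball[OF asm f])
  }
  obtain l a where la: "block_decomp M r \<alpha> f l a" using f by (auto simp: block_space_def)
  show "padic_hardy M f \<in> block_space M r \<alpha>"
    using block_decomp_padic_hardy[OF asm f la] in_Lr_loc_padic_hardy[OF asm f]
    unfolding block_space_def by blast
  have "block_norm M r \<alpha> (padic_hardy M f) / ?C \<le> block_norm M r \<alpha> f"
    unfolding block_norm_def[of M r \<alpha> f]
  proof (rule cInf_greatest)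
    show "{\<Sum>k. norm (l k) |l. \<exists>a. block_decomp M r \<alpha> f l a} \<noteq> {}" using la by blast
    fix s assume "s \<in> {\<Sum>k. norm (l k) |l. \<exists>a. block_decomp M r \<alpha> f l a}"
    then obtain l a where s: "s = (\<Sum>k. norm (l k))" and la: "block_decomp M r \<alpha> f l a" by blast
    obtain l' a' where l': "block_decomp M r \<alpha> (padic_hardy M f) l' a'"
      "(\<Sum>k. norm (l' k)) \<le> ?C * (\<Sum>k. norm (l k))"
      by (rule block_decomp_padic_hardy[OF asm f la])
    have "block_norm M r \<alpha> (padic_hardy M f) \<le> (\<Sum>k. norm (l' k))"
      unfolding block_norm_def
    proof (rule cInf_lower)
      show "bdd_below {\<Sum>k. norm (l k) |l. \<exists>a. block_decomp M r \<alpha> (padic_hardy M f) l a}"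
        by (auto simp: block_decomp_def intro!: bdd_belowI[of _ 0] suminf_nonneg)
    qed (use l' in blast)
    then have "block_norm M r \<alpha> (padic_hardy M f) \<le> s * ?C" using l'(2) s by (simp add: mult.commute)
    then show "block_norm M r \<alpha> (padic_hardy M f) / ?C \<le> s"
      by (simp only: pos_divide_le_eq[OF C])
  qed
  then show "block_norm M r \<alpha> (padic_hardy M f) \<le> ?C * block_norm M r \<alpha> f"
    by (simp only: pos_divide_le_eq[OF C] mult.commute)
qed

end
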